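(* Let $p>3$ be a prime and $a_1,a_2,a_3\in\mathbb{Z}_p$. Put $P=-2a_1^3+9a_1a_2-27a_3$ and $Q=(a_1^2-3a_2)^3$, and suppose $PQ(P^2-Q)(P^2-3Q)(P^2-4Q)\not\equiv 0\pmod p$. Then $N_p(x^3+a_1x^2+a_2x+a_3)=3$ if and only if $$\sum_{k=1}^{[p/3]}\binom{3k}{k}\Big(\frac{4Q-P^2}{27Q}\Big)^k\equiv 0\pmod p,$$ and $N_p(x^3+a_1x^2+a_2x+a_3)=1$ if and only if $$x\equiv \frac{P}{3(a_1^2-3a_2)}\sum_{k=0}^{[p/3]}\binom{3k}{k}\Big(\frac{4Q-P^2}{27Q}\Big)^k-\frac{a_1}{3}\pmod p$$ is a solution of the congruence $x^3+a_1x^2+a_2x+a_3\equiv 0\pmod p$.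
   Context: For a prime $p$, $\mathbb{Z}_p$ denotes the set of rational numbers whose denominator is not divisible by $p$; congruences modulo $p$ are taken in this ring. $[x]$ is the greatest integer not exceeding $x$. $N_p(f(x))$ denotes the number of solutions (residue classes $x$ modulo $p$) of the congruence $f(x)\equiv 0\pmod p$. *)

theory Defs
  imports Complex_Main "HOL-Computational_Algebra.Primes" "HOL-Computational_Algebra.Polynomial"
begin

text \<open>\<open>Z_loc p\<close> is the ring written $\mathbb{Z}_p$ in the source: the localization of the
  integers at \<open>p\<close> inside the rationals, not the \<open>p\<close>-adic integers.\<close>

definition Z_loc :: "nat \<Rightarrow> rat set" where
  "Z_loc p = {x. \<not> int p dvd snd (quotient_of x)}"

text \<open>The library's \<open>cong\<close> is degenerate on the field \<open>rat\<close>, so congruence modulo the ideal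
  \<open>p\<close> \<open>Z_loc p\<close> is introduced here.\<close>

definition cong_loc :: "nat \<Rightarrow> rat \<Rightarrow> rat \<Rightarrow> bool" where
  "cong_loc p x y \<longleftrightarrow> (\<exists>z\<in>Z_loc p. x - y = of_nat p * z)"

text \<open>Intended for polynomials with coefficients in \<open>Z_loc p\<close>. Residue classes are counted via
  their representatives \<open>0, \<dots>, p - 1\<close>; for prime \<open>p\<close> these represent every class of \<open>Z_loc p\<close>
  modulo \<open>p\<close> exactly once.\<close>

definition num_sols :: "nat \<Rightarrow> rat poly \<Rightarrow> nat" where
  "num_sols p f = card {x \<in> {0..<p}. cong_loc p (poly f (of_nat x)) 0}"

end

(*
Put u = P^2/Q. The substitution x = (P t/(a_1^2 - 3 a_2) - a_1)/3 turns the cubic into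
u t^3 - 3 t - 1. Since binom(3k, k) = (-27)^k binom([p/3] + k, 2k) modulo p, the binomial sum is
congruent to the Lucas quotient s = (b^m + b^(-m))/(b + b^(-1)), where (b + b^(-1))^2 = u and
m = 2[p/3] + 1. As 3m = 2p + 1 or 2p - 1, the Frobenius gives that u s^3 - 3 s equals 1 or u - 3
according to whether -3u(u - 4), which is the discriminant up to squares, is a non-square or a
square. In the first case s is a
root, and the only one. In the second case there are no roots or three; a root forces s = 1 by
composing Lucas sequences with tripling. Conversely s = 1 makes u - 2 a zero of a polynomial of
degree (p - 1)/6 - 1 or (p + 1)/6 - 1, and an explicit family of completely split cubics already
accounts for that many zeros.
*)
theory Submission
  imports Defs "HOL-Number_Theory.Euler_Criterion"
begin

section \<open>Lucas sequences\<close>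

text \<open>The element b lives in general only in the quadratic extension of the field with p
  elements. Lucas sequences in x = u - 2 = b^2 + b^-2 keep all computations among the integers, so
  that congruences suffice. The normal form u t^3 - 3 t - 1 is dictated by tripling: passing from m
  to 3 m sends the quotient s to u s^3 - 3 s. The delicate point is that s = 1 forces a root. Put
  \<gamma> = b^2 and p = 6 h + e with e = 1 or -1. A square discriminant gives \<gamma>^(6h) = 1,
  and s = 1 then means \<gamma>^(2h) = 1, apart from the case \<gamma>^3 = 1, which u \<noteq> 1
  rules out. So \<gamma> should be a cube in a cyclic group of order 6 h of the extension. Counting
  replaces the group argument: \<gamma>^(2h) = 1 becomes the vanishing of U_h(u - 2), a polynomial
  of degree h - 1, while the split family has at least 6 h - 6 admissible parameters, at most 6 of
  them for each u.\<close>

fun lucas_U :: "int \<Rightarrow> nat \<Rightarrow> int" where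
  "lucas_U x 0 = 0"
| "lucas_U x (Suc 0) = 1"
| "lucas_U x (Suc (Suc n)) = x * lucas_U x (Suc n) - lucas_U x n"

text \<open>If x = \<gamma> + \<gamma>^-1, then \<open>lucas_U x n\<close> is (\<gamma>^n -
  \<gamma>^-n) / (\<gamma> - \<gamma>^-1) and this is \<gamma>^n + \<gamma>^-n. The encoding through
  \<open>lucas_U\<close> reduces its identities to those of a single recurrence.\<close>

definition lucas_V :: "int \<Rightarrow> nat \<Rightarrow> int" where
  "lucas_V x n = 2 * lucas_U x (Suc n) - x * lucas_U x n"

lemma lucas_U_add:
  "lucas_U x (Suc (m + k)) = lucas_U x (Suc m) * lucas_U x (Suc k) - lucas_U x m * lucas_U x k"
proof (induction x k rule: lucas_U.induct)
  case (3 x n)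
  have "lucas_U x (Suc (m + Suc (Suc n))) = x * lucas_U x (Suc (m + Suc n)) - lucas_U x (Suc (m + n))"
    by simp
  also have "\<dots> = lucas_U x (Suc m) * lucas_U x (Suc (Suc (Suc n))) - lucas_U x m * lucas_U x (Suc (Suc n))"
    unfolding 3 by (simp add: algebra_simps)
  finally show ?case .
qed simp_all

text \<open>The form a^2 - x a b + b^2 is the norm of a - b \<gamma>, here a power of the unit
  \<gamma>. Algebraically, replacing (a, b) by (x a - b, a) does not change it.\<close>

lemma lucas_U_norm:
  "(lucas_U x (Suc n))\<^sup>2 - x * lucas_U x (Suc n) * lucas_U x n + (lucas_U x n)\<^sup>2 = 1"
proof (induction n)
  case (Suc n)
  have "(x * a - b)\<^sup>2 - x * (x * a - b) * a + a\<^sup>2 = a\<^sup>2 - x * a * b + b\<^sup>2" for a b :: int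
    by (simp add: power2_eq_square algebra_simps)
  with Suc show ?case by simp
qed simp

lemma lucas_V_norm: "(lucas_V x n)\<^sup>2 - (x\<^sup>2 - 4) * (lucas_U x n)\<^sup>2 = 4"
proof -
  have "(2 * a - x * b)\<^sup>2 - (x\<^sup>2 - 4) * b\<^sup>2 = 4 * (a\<^sup>2 - x * a * b + b\<^sup>2)" for a b :: int
    by (simp add: power2_eq_square algebra_simps)
  then show ?thesis unfolding lucas_V_def by (simp only: lucas_U_norm)
qed

lemma lucas_V_Suc: "2 * lucas_V x (Suc n) = x * lucas_V x n + (x\<^sup>2 - 4) * lucas_U x n"
  unfolding lucas_V_def by (simp add: algebra_simps power2_eq_square)

lemma lucas_U_Suc: "2 * lucas_U x (Suc n) = x * lucas_U x n + lucas_V x n"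
  unfolding lucas_V_def by simp

lemma lucas_U_Suc_double:
  "lucas_U x (Suc (2 * n)) = (lucas_U x (Suc n))\<^sup>2 - (lucas_U x n)\<^sup>2"
  using lucas_U_add[of x n n] by (simp add: power2_eq_square mult_2)

lemma lucas_U_double: "lucas_U x (2 * n) = lucas_U x n * lucas_V x n"
proof (cases n)
  case (Suc k)
  have "lucas_U x (2 * n) = lucas_U x (Suc (n + k))" using Suc by (simp add: mult_2)
  then show ?thesis unfolding lucas_U_add Suc lucas_V_def by (simp add: algebra_simps)
qed simp

lemma lucas_U_Suc_triple:
  "lucas_U x (Suc (3 * n)) = ((lucas_U x (Suc n))\<^sup>2 - (lucas_U x n)\<^sup>2) * lucas_U x (Suc n)
     - lucas_U x n * lucas_V x n * lucas_U x n"
proof -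
  have "3 * n = 2 * n + n" by simp
  then show ?thesis by (simp only: lucas_U_add lucas_U_Suc_double lucas_U_double)
qed

lemma lucas_U_Suc_Suc_triple:
  "lucas_U x (Suc (Suc (3 * n))) = lucas_U x (Suc n) * lucas_V x (Suc n) * lucas_U x (Suc n)
     - ((lucas_U x (Suc n))\<^sup>2 - (lucas_U x n)\<^sup>2) * lucas_U x n"
proof -
  have "Suc (3 * n) = Suc (2 * n) + n" "Suc (Suc (2 * n)) = 2 * Suc n" by simp_all
  then show ?thesis by (simp only: lucas_U_add lucas_U_Suc_double lucas_U_double)
qed

lemma lucas_V_add: "2 * lucas_V x (m + k) = lucas_V x m * lucas_V x k + (x\<^sup>2 - 4) * lucas_U x m * lucas_U x k"
proof (induction x k rule: lucas_U.induct)
  case (2 x) then show ?case using lucas_V_Suc[of x m] by (simp add: lucas_V_def)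
next
  case (3 x n)
  have V: "lucas_V x (Suc (Suc j)) = x * lucas_V x (Suc j) - lucas_V x j" for j
    by (simp add: lucas_V_def algebra_simps)
  have "2 * lucas_V x (m + Suc (Suc n)) = x * (2 * lucas_V x (m + Suc n)) - 2 * lucas_V x (m + n)"
    using V[of "m + n"] by (simp add: algebra_simps)
  also have "\<dots> = lucas_V x m * lucas_V x (Suc (Suc n))
      + (x\<^sup>2 - 4) * lucas_U x m * lucas_U x (Suc (Suc n))"
    unfolding 3 V by (simp add: algebra_simps)
  finally show ?case .
qed (simp add: lucas_V_def)

lemma lucas_V_double: "lucas_V x (2 * n) = 2 + (x\<^sup>2 - 4) * (lucas_U x n)\<^sup>2"
proof -
  have "2 * lucas_V x (2 * n) = (lucas_V x n)\<^sup>2 + (x\<^sup>2 - 4) * (lucas_U x n)\<^sup>2"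
    using lucas_V_add[of x n n] unfolding mult_2[of n] power2_eq_square[of "lucas_V x n"]
      power2_eq_square[of "lucas_U x n"] mult.assoc .
  then show ?thesis using lucas_V_norm[of x n] by linarith
qed

lemma lucas_V_triple: "lucas_V x (3 * n) = (lucas_V x n) ^ 3 - 3 * lucas_V x n"
proof -
  have 1: "2 * lucas_V x (3 * n) = (2 + (x\<^sup>2 - 4) * (lucas_U x n)\<^sup>2) * lucas_V x n
      + (x\<^sup>2 - 4) * (lucas_U x n * lucas_V x n) * lucas_U x n"
    using lucas_V_add[of x "2 * n" n] unfolding lucas_V_double lucas_U_double by simp
  have "2 * v3 = 2 * (v ^ 3 - 3 * v)"
    if "2 * v3 = (2 + d * u\<^sup>2) * v + d * (u * v) * u" "d * u\<^sup>2 = v\<^sup>2 - 4" for v3 v d u :: int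
  proof -
    have "2 * v3 = (2 + 2 * (d * u\<^sup>2)) * v"
      unfolding that(1) by (simp add: algebra_simps power2_eq_square)
    then show ?thesis unfolding that(2) by (simp add: algebra_simps power2_eq_square power3_eq_cube)
  qed
  moreover have "(x\<^sup>2 - 4) * (lucas_U x n)\<^sup>2 = (lucas_V x n)\<^sup>2 - 4"
    using lucas_V_norm[of x n] by linarith
  ultimately have "2 * lucas_V x (3 * n) = 2 * ((lucas_V x n) ^ 3 - 3 * lucas_V x n)"
    using 1 by blast
  then show ?thesis by (rule mult_left_cancel[THEN iffD1, rotated]) simp
qed

section \<open>Composition with index tripling\<close>

text \<open>Every third term of a recurrence with characteristic roots \<gamma> and \<gamma>^-1
  obeys the recurrence with roots \<gamma>^3 and \<gamma>^-3, whose sum is x^3 - 3 x.\<close>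

lemma lucas_step_three:
  "lucas_U x (n + 6) = (x ^ 3 - 3 * x) * lucas_U x (n + 3) - lucas_U x n"
proof -
  have "n + 6 = Suc (Suc (Suc (Suc (Suc (Suc n)))))" "n + 3 = Suc (Suc (Suc n))"
    by simp_all
  then show ?thesis
    by (simp only: lucas_U.simps) (simp add: algebra_simps power3_eq_cube)
qed

lemma lucas_V_comp_three: "lucas_V (x ^ 3 - 3 * x) n = lucas_V x (3 * n)"
proof (induction "x ^ 3 - 3 * x" n rule: lucas_U.induct)
  case 1 show ?case by (simp add: lucas_V_def)
next
  case 2
  have "lucas_V y (Suc 0) = y" for y by (simp add: lucas_V_def)
  then show ?case using lucas_V_triple[of x "Suc 0"] by simp
next
  case (3 n)
  have V: "lucas_V y (Suc (Suc j)) = y * lucas_V y (Suc j) - lucas_V y j" for j y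
    by (simp add: lucas_V_def algebra_simps)
  have "lucas_V x (3 * n + 6) = (x ^ 3 - 3 * x) * lucas_V x (3 * n + 3) - lucas_V x (3 * n)"
  proof -
    have "lucas_V x (3 * n + 6) = 2 * lucas_U x (Suc (3 * n) + 6) - x * lucas_U x (3 * n + 6)"
      "lucas_V x (3 * n + 3) = 2 * lucas_U x (Suc (3 * n) + 3) - x * lucas_U x (3 * n + 3)"
      by (simp_all add: lucas_V_def)
    then show ?thesis
      unfolding lucas_step_three lucas_V_def by (simp add: algebra_simps)
  qed
  moreover have "3 * Suc n = 3 * n + 3" "3 * Suc (Suc n) = 3 * n + 6" by simp_all
  ultimately show ?case unfolding V 3 by presburger
qed

text \<open>With \<open>x = \<beta>\<^sup>2 + \<beta>\<^sup>-\<^sup>2\<close> this is \<open>(\<beta>\<^bsup>2n+1\<^esup> + \<beta>\<^bsup>-2n-1\<^esup>) / (\<beta> + \<beta>\<^sup>-\<^sup>1)\<close>.\<close>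

definition lucas_B :: "int \<Rightarrow> nat \<Rightarrow> int" where
  "lucas_B x n = lucas_U x (Suc n) - lucas_U x n"

text \<open>Since 2 (3 n + 1) + 1 = 3 (2 n + 1), this is (w^3 - 3 w) / (\<beta> + \<beta>^-1) for w
  = \<beta>^(2n+1) + \<beta>^(-2n-1), where (\<beta> + \<beta>^-1)^2 = x + 2.\<close>

lemma lucas_B_triple: "lucas_B x (3 * n + 1) = (x + 2) * (lucas_B x n) ^ 3 - 3 * lucas_B x n"
proof -
  define a b where "a = lucas_U x (Suc n)" and "b = lucas_U x n"
  have norm: "a\<^sup>2 - x * a * b + b\<^sup>2 = 1"
    unfolding a_def b_def by (rule lucas_U_norm)
  have V: "lucas_V x (Suc n) = x * a - 2 * b" "lucas_V x n = 2 * a - x * b"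
    by (simp_all add: lucas_V_def a_def b_def algebra_simps)
  have "lucas_B x (3 * n + 1)
      = a * (x * a - 2 * b) * a - (a\<^sup>2 - b\<^sup>2) * b - ((a\<^sup>2 - b\<^sup>2) * a - b * (2 * a - x * b) * b)"
    unfolding lucas_B_def Suc_eq_plus1[symmetric] lucas_U_Suc_triple lucas_U_Suc_Suc_triple V
    by (simp only: a_def b_def)
  also have "\<dots> = (x + 2) * (a - b) ^ 3 - 3 * ((a\<^sup>2 - x * a * b + b\<^sup>2) * (a - b))"
    by (simp add: power2_eq_square power3_eq_cube algebra_simps)
  finally show ?thesis unfolding norm by (simp add: lucas_B_def a_def b_def)
qed

text \<open>Replacing \<beta> by \<beta>^3 triples the exponent, but it also changes the
  denominator; the factor x - 1 is (\<beta>^3 + \<beta>^-3) / (\<beta> + \<beta>^-1).\<close>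

lemma lucas_B_comp_three: "(x - 1) * lucas_B (x ^ 3 - 3 * x) n = lucas_B x (3 * n + 1)"
proof (induction "x ^ 3 - 3 * x" n rule: lucas_U.induct)
  case 1 show ?case by (simp add: lucas_B_def)
next
  case 2
  have "lucas_U x 5 = x * (x * (x * x - 1) - x) - (x * x - 1)"
    "lucas_U x 4 = x * (x * x - 1) - x" "lucas_U x 2 = x"
    by (simp_all add: numeral_eq_Suc)
  then show ?case by (simp add: lucas_B_def algebra_simps power3_eq_cube)
next
  case (3 n)
  have B: "lucas_B y (Suc (Suc j)) = y * lucas_B y (Suc j) - lucas_B y j" for j y
    by (simp add: lucas_B_def algebra_simps)
  have "lucas_B x (3 * n + 7) = (x ^ 3 - 3 * x) * lucas_B x (3 * n + 4) - lucas_B x (3 * n + 1)"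
    unfolding lucas_B_def using lucas_step_three[of x "3 * n + 1"] lucas_step_three[of x "3 * n + 2"]
    by (simp add: algebra_simps)
  moreover have "(x - 1) * lucas_B (x ^ 3 - 3 * x) (Suc (Suc n))
      = (x ^ 3 - 3 * x) * ((x - 1) * lucas_B (x ^ 3 - 3 * x) (Suc n)) - (x - 1) * lucas_B (x ^ 3 - 3 * x) n"
    unfolding B by (simp add: algebra_simps)
  moreover have "3 * Suc n + 1 = 3 * n + 4" "3 * Suc (Suc n) + 1 = 3 * n + 7" by simp_all
  ultimately show ?case using 3 by presburger
qed

section \<open>Half-index factorizations\<close>

text \<open>This and the next two identities rest on (A - A^-1) (B - B^-1) = (A B + (A B)^-1) - (A
  B^-1 + A^-1 B) for powers A, B of \<beta> with equal or consecutive exponents. In these terms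
  \<open>lucas_U x (Suc h) + lucas_U x h\<close> is (\<beta>^(2h+1) - \<beta>^(-2h-1)) / (\<beta> -
  \<beta>^-1).\<close>

lemma lucas_B_even:
  "lucas_B x (2 * h) - 1 = (x - 2) * lucas_U x h * (lucas_U x (Suc h) + lucas_U x h)"
proof -
  define a b where "a = lucas_U x (Suc h)" and "b = lucas_U x h"
  have norm: "a\<^sup>2 - x * a * b + b\<^sup>2 = 1"
    unfolding a_def b_def by (rule lucas_U_norm)
  have "a\<^sup>2 - b\<^sup>2 - b * (2 * a - x * b) - 1
      = (x - 2) * b * (a + b) + (a\<^sup>2 - x * a * b + b\<^sup>2 - 1)"
    by (simp add: power2_eq_square algebra_simps)
  then show ?thesis
    unfolding norm unfolding a_def b_def lucas_B_def lucas_U_Suc_double lucas_U_double lucas_V_def by simp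
qed

lemma lucas_B_odd:
  "lucas_B x (Suc (2 * h)) - 1 = (x - 2) * lucas_U x (Suc h) * (lucas_U x (Suc h) + lucas_U x h)"
proof -
  define a b where "a = lucas_U x (Suc h)" and "b = lucas_U x h"
  have norm: "a\<^sup>2 - x * a * b + b\<^sup>2 = 1"
    unfolding a_def b_def by (rule lucas_U_norm)
  have "x * (a\<^sup>2 - b\<^sup>2) - b * (2 * a - x * b) - (a\<^sup>2 - b\<^sup>2) - 1
      = (x - 2) * a * (a + b) + (a\<^sup>2 - x * a * b + b\<^sup>2 - 1)"
    by (simp add: power2_eq_square algebra_simps)
  then show ?thesis
    unfolding norm unfolding a_def b_def lucas_B_def lucas_U.simps lucas_U_Suc_double lucas_U_double lucas_V_def by simp
qed

lemma lucas_V_odd: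
  "lucas_V x (Suc (2 * h)) - 2 = (x - 2) * (lucas_U x (Suc h) + lucas_U x h)\<^sup>2"
proof -
  define a b where "a = lucas_U x (Suc h)" and "b = lucas_U x h"
  have norm: "a\<^sup>2 - x * a * b + b\<^sup>2 = 1"
    unfolding a_def b_def by (rule lucas_U_norm)
  have "2 * (x * (a\<^sup>2 - b\<^sup>2) - b * (2 * a - x * b)) - x * (a\<^sup>2 - b\<^sup>2) - 2
      = (x - 2) * (a + b)\<^sup>2 + 2 * (a\<^sup>2 - x * a * b + b\<^sup>2 - 1)"
    by (simp add: power2_eq_square algebra_simps)
  then show ?thesis
    unfolding norm unfolding a_def b_def lucas_V_def lucas_U.simps lucas_U_Suc_double lucas_U_double by simp
qed

text \<open>\<open>lucas_B\<close> and \<open>lucas_U\<close> feed each other through Pascal's rule,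
  so both expansions are proved together. Summing up to a common bound N > n, with vanishing extra
  terms, lets Pascal's rule act termwise.\<close>

lemma lucas_B_binomial:
  "lucas_B (x + 2) n = (\<Sum>k\<le>n. int ((n + k) choose (2 * k)) * x ^ k)"
proof -
  have "lucas_B (x + 2) n = (\<Sum>k\<le>N. int ((n + k) choose (2 * k)) * x ^ k) \<and>
        lucas_U (x + 2) (Suc n) = (\<Sum>k\<le>N. int ((Suc n + k) choose (Suc (2 * k))) * x ^ k)"
    if "n < N" for N using that
  proof (induction n)
    case 0
    have "(\<Sum>k\<le>N. int ((0 + k) choose (2 * k)) * x ^ k) = (\<Sum>k\<in>{0}. int ((0 + k) choose (2 * k)) * x ^ k)"
      by (rule sum.mono_neutral_right) (auto simp: binomial_eq_0)
    moreover have "(\<Sum>k\<le>N. int ((Suc 0 + k) choose (Suc (2 * k))) * x ^ k) = (\<Sum>k\<in>{0}. int ((Suc 0 + k) choose (Suc (2 * k))) * x ^ k)"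
      by (rule sum.mono_neutral_right) (auto simp: binomial_eq_0)
    ultimately show ?case by (simp add: lucas_B_def)
  next
    case (Suc n)
    let ?B = "\<Sum>k\<le>N. int ((n + k) choose (2 * k)) * x ^ k"
    let ?U = "\<Sum>k\<le>N. int ((Suc n + k) choose (Suc (2 * k))) * x ^ k"
    let ?B' = "\<Sum>k\<le>N. int ((Suc n + k) choose (2 * k)) * x ^ k"
    let ?U' = "\<Sum>k\<le>N. int ((Suc (Suc n) + k) choose (Suc (2 * k))) * x ^ k"
    obtain M where M: "N = Suc M" using Suc.prems by (cases N) auto
    have "?B' = 1 + (\<Sum>k\<le>M. int ((Suc n + Suc k) choose (2 * Suc k)) * x ^ Suc k)"
      unfolding M by (simp only: sum.atMost_Suc_shift) simp
    also have "\<dots> = 1 + (\<Sum>k\<le>M. int ((n + Suc k) choose (2 * Suc k)) * x ^ Suc k)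
        + x * (\<Sum>k\<le>M. int ((Suc n + k) choose (Suc (2 * k))) * x ^ k)"
      by (simp add: sum.distrib sum_distrib_left algebra_simps)
    also have "1 + (\<Sum>k\<le>M. int ((n + Suc k) choose (2 * Suc k)) * x ^ Suc k) = ?B"
      unfolding M by (simp only: sum.atMost_Suc_shift) simp
    also have "(\<Sum>k\<le>M. int ((Suc n + k) choose (Suc (2 * k))) * x ^ k) = ?U"
      using Suc.prems unfolding M by (simp add: binomial_eq_0)
    finally have 1: "?B' = ?B + x * ?U" .
    have 2: "?U' = ?U + ?B'"
      by (simp add: sum.distrib algebra_simps)
    have "lucas_B (x + 2) n = ?B" "lucas_U (x + 2) (Suc n) = ?U" using Suc by simp_all
    moreover have "lucas_B (x + 2) (Suc n) = lucas_B (x + 2) n + x * lucas_U (x + 2) (Suc n)"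
      "lucas_U (x + 2) (Suc (Suc n)) = lucas_U (x + 2) (Suc n) + lucas_B (x + 2) (Suc n)"
      by (simp_all add: lucas_B_def algebra_simps)
    ultimately show ?case using 1 2 by presburger
  qed
  from this[of "Suc n"] show ?thesis by (simp add: binomial_eq_0)
qed

section \<open>Lucas sequences modulo a prime\<close>

text \<open>With s a square root of x^2 - 4, (x + s) / 2 is \<gamma>. The complex numbers serve only
  to supply s.\<close>

lemma two_power_lucas:
  fixes x :: int and s :: complex
  assumes "s\<^sup>2 = of_int (x\<^sup>2 - 4)"
  shows "2 * (of_int x + s) ^ n = 2 ^ n * (of_int (lucas_V x n) + of_int (lucas_U x n) * s)"
proof (induction n)
  case (Suc n)
  have V: "2 * complex_of_int (lucas_V x (Suc n))
      = of_int x * of_int (lucas_V x n) + s\<^sup>2 * of_int (lucas_U x n)"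
    unfolding assms of_int_mult[symmetric] of_int_add[symmetric] lucas_V_Suc[symmetric] by simp
  have U: "2 * complex_of_int (lucas_U x (Suc n)) = of_int x * of_int (lucas_U x n) + of_int (lucas_V x n)"
    unfolding of_int_mult[symmetric] of_int_add[symmetric] lucas_U_Suc[symmetric] by simp
  have "2 * (of_int x + s) ^ Suc n = (of_int x + s) * (2 * (of_int x + s) ^ n)" by simp
  also have "\<dots> = 2 ^ n * ((of_int x * of_int (lucas_V x n) + s\<^sup>2 * of_int (lucas_U x n))
      + (of_int x * of_int (lucas_U x n) + of_int (lucas_V x n)) * s)"
    unfolding Suc by (simp add: algebra_simps power2_eq_square)
  also have "\<dots> = 2 ^ Suc n * (of_int (lucas_V x (Suc n)) + of_int (lucas_U x (Suc n)) * s)"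
    unfolding V[symmetric] U[symmetric] by (simp add: algebra_simps)
  finally show ?case .
qed (simp add: lucas_V_def)

text \<open>Adding and subtracting the expansions of (x + s)^n and (x - s)^n leaves the even and the
  odd powers of s. For \<open>lucas_U\<close> one factor s is cancelled, which requires x^2 \<noteq>
  4.\<close>

lemma two_power_lucas_V:
  "2 ^ n * lucas_V x n = (\<Sum>k\<le>n. int (n choose k) * x ^ (n - k) * (if even k then 2 * (x\<^sup>2 - 4) ^ (k div 2) else 0))"
  and two_power_lucas_U:
  "x\<^sup>2 \<noteq> 4 \<Longrightarrow> 2 ^ n * lucas_U x n = (\<Sum>k\<le>n. int (n choose k) * x ^ (n - k) * (if odd k then 2 * (x\<^sup>2 - 4) ^ (k div 2) else 0))"
proof -
  define s where "s = csqrt (of_int (x\<^sup>2 - 4))"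
  have s: "s\<^sup>2 = of_int (x\<^sup>2 - 4)" by (simp only: s_def power2_csqrt)
  then have s': "(- s)\<^sup>2 = of_int (x\<^sup>2 - 4)" by (simp only: power2_minus)
  define L where "L = 2 ^ n * complex_of_int (lucas_V x n)"
  define M where "M = 2 ^ n * (complex_of_int (lucas_U x n) * s)"
  have plus: "2 * (of_int x + s) ^ n = L + M" and minus: "2 * (of_int x + - s) ^ n = L - M"
    unfolding two_power_lucas[OF s] two_power_lucas[OF s'] L_def M_def by (simp_all add: algebra_simps)
  have sk: "s ^ k = of_int ((x\<^sup>2 - 4) ^ (k div 2)) * (if even k then 1 else s)" for k
  proof -
    have "s ^ k = s ^ (2 * (k div 2) + k mod 2)" by simp
    also have "\<dots> = (s\<^sup>2) ^ (k div 2) * s ^ (k mod 2)" unfolding power_add power_mult ..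
    finally show ?thesis unfolding s by (simp add: parity_cases odd_iff_mod_2_eq_one even_iff_mod_2_eq_zero)
  qed
  have "2 * L = 2 * ((of_int x + s) ^ n + (of_int x + - s) ^ n)"
    unfolding distrib_left plus minus by simp
  then have "L = (of_int x + s) ^ n + (of_int x + - s) ^ n"
    by (rule mult_left_cancel[THEN iffD1, rotated]) simp
  also have "\<dots> = (\<Sum>k\<le>n. of_nat (n choose k) * of_int x ^ (n - k) * (s ^ k + (- s) ^ k))"
    unfolding add.commute[of "of_int x"] binomial_ring sum.distrib[symmetric]
    by (rule sum.cong) (simp_all add: algebra_simps)
  also have "\<dots> = of_int (\<Sum>k\<le>n. int (n choose k) * x ^ (n - k) * (if even k then 2 * (x\<^sup>2 - 4) ^ (k div 2) else 0))"
    unfolding of_int_sum by (rule sum.cong) (auto simp: sk power_minus_odd)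
  finally have "complex_of_int (2 ^ n * lucas_V x n) = of_int (\<Sum>k\<le>n. int (n choose k) * x ^ (n - k) * (if even k then 2 * (x\<^sup>2 - 4) ^ (k div 2) else 0))"
    unfolding L_def by simp
  then show "2 ^ n * lucas_V x n = (\<Sum>k\<le>n. int (n choose k) * x ^ (n - k) * (if even k then 2 * (x\<^sup>2 - 4) ^ (k div 2) else 0))"
    unfolding of_int_eq_iff .
  assume "x\<^sup>2 \<noteq> 4"
  then have "x\<^sup>2 - 4 \<noteq> 0" by linarith
  then have "s \<noteq> 0" using s by (metis of_int_eq_0_iff zero_power2)
  have "2 * M = 2 * ((of_int x + s) ^ n - (of_int x + - s) ^ n)"
    unfolding right_diff_distrib plus minus by simp
  then have "M = (of_int x + s) ^ n - (of_int x + - s) ^ n"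
    by (rule mult_left_cancel[THEN iffD1, rotated]) simp
  also have "\<dots> = (\<Sum>k\<le>n. of_nat (n choose k) * of_int x ^ (n - k) * (s ^ k - (- s) ^ k))"
    unfolding add.commute[of "of_int x"] binomial_ring sum_subtractf[symmetric]
    by (rule sum.cong) (simp_all add: algebra_simps)
  also have "\<dots> = of_int (\<Sum>k\<le>n. int (n choose k) * x ^ (n - k) * (if odd k then 2 * (x\<^sup>2 - 4) ^ (k div 2) else 0)) * s"
    unfolding of_int_sum sum_distrib_right by (rule sum.cong) (auto simp: sk power_minus_odd)
  finally have "complex_of_int (2 ^ n * lucas_U x n) * s = of_int (\<Sum>k\<le>n. int (n choose k) * x ^ (n - k) * (if odd k then 2 * (x\<^sup>2 - 4) ^ (k div 2) else 0)) * s"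
    unfolding M_def by (simp add: mult.assoc)
  then have "complex_of_int (2 ^ n * lucas_U x n) = of_int (\<Sum>k\<le>n. int (n choose k) * x ^ (n - k) * (if odd k then 2 * (x\<^sup>2 - 4) ^ (k div 2) else 0))"
    using \<open>s \<noteq> 0\<close> mult_right_cancel by blast
  then show "2 ^ n * lucas_U x n = (\<Sum>k\<le>n. int (n choose k) * x ^ (n - k) * (if odd k then 2 * (x\<^sup>2 - 4) ^ (k div 2) else 0))"
    unfolding of_int_eq_iff .
qed

lemma fermat_int:
  fixes p :: nat and a :: int
  assumes "prime p"
  shows "[a ^ p = a] (mod int p)"
proof (cases "int p dvd a")
  case True
  then show ?thesis using assms prime_gt_0_nat[of p]
    by (simp add: cong_iff_dvd_diff dvd_diff dvd_power_same dvd_trans[OF True] dvd_power)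
next
  case False
  define b where "b = nat (a mod int p)"
  have b: "int b = a mod int p"
    using prime_gt_0_nat[OF assms] by (simp add: b_def)
  with False have "\<not> p dvd b"
    by (metis dvd_mod_iff dvd_refl of_nat_dvd_iff)
  then have "[int (b ^ (p - 1)) = int 1] (mod int p)"
    using fermat_theorem[OF assms] by (simp only: cong_int_iff)
  then have "[a ^ (p - 1) = 1] (mod int p)"
    by (simp add: b cong_def power_mod)
  then have "[a ^ (p - 1) * a = 1 * a] (mod int p)"
    by (rule cong_scalar_right)
  then show ?thesis using prime_gt_0_nat[OF assms] by (simp add: power_eq_if mult.commute)
qed

text \<open>The Frobenius in elementary form: the inner binomial coefficients vanish modulo p and
  only the two end terms survive.\<close>

lemma prime_cong_binomial_sum:
  fixes p :: nat and f :: "nat \<Rightarrow> int"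
  assumes "prime p"
  shows "[(\<Sum>k\<le>p. int (p choose k) * f k) = f 0 + f p] (mod int p)"
proof -
  have p: "p \<noteq> 0" using assms by auto
  have split: "{..p} = insert 0 (insert p {0<..<p})" using p by auto
  have "int p dvd (\<Sum>k\<in>{0<..<p}. int (p choose k) * f k)"
  proof (rule dvd_sum)
    fix k assume "k \<in> {0<..<p}"
    then have "p dvd (p choose k)" using assms by (intro dvd_choose_prime) auto
    then show "int p dvd int (p choose k) * f k" by (simp add: dvd_mult2)
  qed
  moreover have "(\<Sum>k\<le>p. int (p choose k) * f k) = f 0 + (f p + (\<Sum>k\<in>{0<..<p}. int (p choose k) * f k))"
    unfolding split using p by simp
  ultimately show ?thesis by (simp add: cong_iff_dvd_diff)
qed

lemma prime_cong_two_cancel: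
  fixes p :: nat
  assumes "prime p" "2 < p" "[2 ^ p * a = 2 * b] (mod int p)"
  shows "[a = b] (mod int p)"
proof -
  have "[2 ^ p * a = 2 * a] (mod int p)"
    using fermat_int[OF assms(1), of 2] by (rule cong_scalar_right)
  then have "[2 * a = 2 * b] (mod int p)" using assms(3) cong_sym cong_trans by blast
  moreover have "coprime 2 (int p)"
    using assms by (metis coprime_commute coprime_int_iff of_nat_numeral primes_coprime two_is_prime_nat nat_neq_iff)
  ultimately show ?thesis by (simp add: cong_mult_lcancel)
qed

lemma lucas_V_prime:
  assumes "prime p" "2 < p"
  shows "[lucas_V x p = x] (mod int p)"
proof (rule prime_cong_two_cancel[OF assms])
  have odd: "odd p" using assms prime_odd_nat by auto
  have "[2 ^ p * lucas_V x p = x ^ p * 2] (mod int p)"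
    unfolding two_power_lucas_V mult.assoc
    using prime_cong_binomial_sum[OF assms(1), of "\<lambda>k. x ^ (p - k) * (if even k then 2 * (x\<^sup>2 - 4) ^ (k div 2) else 0)"]
    odd by simp
  then show "[2 ^ p * lucas_V x p = 2 * x] (mod int p)"
    using fermat_int[OF assms(1), of x] by (metis cong_scalar_right cong_trans mult.commute)
qed

lemma lucas_U_prime:
  assumes "prime p" "2 < p" "x\<^sup>2 \<noteq> 4"
  shows "[lucas_U x p = (x\<^sup>2 - 4) ^ ((p - 1) div 2)] (mod int p)"
proof (rule prime_cong_two_cancel[OF assms(1,2)])
  have odd: "odd p" using assms prime_odd_nat by auto
  then have "p div 2 = (p - 1) div 2" by (auto elim: oddE)
  then show "[2 ^ p * lucas_U x p = 2 * (x\<^sup>2 - 4) ^ ((p - 1) div 2)] (mod int p)"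
    unfolding two_power_lucas_U[OF assms(3)] mult.assoc
    using prime_cong_binomial_sum[OF assms(1), of "\<lambda>k. x ^ (p - k) * (if odd k then 2 * (x\<^sup>2 - 4) ^ (k div 2) else 0)"]
    odd by simp
qed

lemma lucas_U_cong: "[x = y] (mod m) \<Longrightarrow> [lucas_U x n = lucas_U y n] (mod m)"
  by (induction y n rule: lucas_U.induct) (auto intro!: cong_diff cong_mult)

lemma lucas_B_cong: "[x = y] (mod m) \<Longrightarrow> [lucas_B x n = lucas_B y n] (mod m)"
  unfolding lucas_B_def by (intro cong_diff lucas_U_cong)

lemma lucas_U_minus_one: "lucas_U (- 1) (3 * k) = 0 \<and> lucas_U (- 1) (Suc (3 * k)) = 1"
proof (induction k)
  case (Suc k)
  have "3 * Suc k = Suc (Suc (Suc (3 * k)))" by simp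
  then show ?case using Suc by (simp only: lucas_U.simps) simp
qed simp

lemma dvd_lincomb:
  fixes m a b :: int
  assumes "m dvd a" "m dvd b" "e = c * a + d * b"
  shows "m dvd e"
  using assms by simp

lemma dvd_lincomb1:
  fixes m a :: int
  assumes "m dvd a" "e = c * a"
  shows "m dvd e"
  using assms by simp

section \<open>Quadratic characters and the Frobenius on Lucas sequences\<close>

locale prime_gt_three =
  fixes p :: nat
  assumes prime: "prime p" and gt: "3 < p"
begin

lemma prime_int: "prime (int p)"
  using prime by simp

lemma dvd_mult_iff: "int p dvd a * b \<longleftrightarrow> int p dvd a \<or> int p dvd b"
  using prime_int by (rule prime_dvd_mult_iff)

lemma dvd_power_iff: "0 < n \<Longrightarrow> int p dvd a ^ n \<longleftrightarrow> int p dvd a"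
  using prime_int by (rule prime_dvd_power_iff)

lemma not_dvd_small: "0 < \<bar>a\<bar> \<Longrightarrow> \<bar>a\<bar> < int p \<Longrightarrow> \<not> int p dvd a"
  using zdvd_not_zless[of "\<bar>a\<bar>" "int p"] by (simp add: dvd_abs_iff)

lemma not_dvd_2 [simp]: "\<not> int p dvd 2" and not_dvd_3 [simp]: "\<not> int p dvd 3"
  using gt not_dvd_small[of 2] not_dvd_small[of 3] by auto

lemma not_dvd_1 [simp]: "\<not> int p dvd 1"
  using gt not_dvd_small[of 1] by auto

lemma not_dvd_4 [simp]: "\<not> int p dvd 4"
  using dvd_mult_iff[of 2 2] by simp

lemma not_dvd_27 [simp]: "\<not> int p dvd 27"
  using dvd_power_iff[of 3 3] by simp

lemma cong_cancel: "\<not> int p dvd c \<Longrightarrow> [c * a = c * b] (mod int p) \<Longrightarrow> [a = b] (mod int p)"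
  by (simp add: cong_iff_dvd_diff right_diff_distrib[symmetric] dvd_mult_iff)

lemma inverse_mod:
  assumes "\<not> int p dvd a"
  obtains b where "[a * b = c] (mod int p)"
proof -
  have "coprime a (int p)"
    using prime_imp_coprime[OF prime_int assms] by (simp add: coprime_commute)
  then obtain b where "[a * b = 1] (mod int p)" using cong_solve_coprime_int by blast
  then have "[a * (b * c) = c] (mod int p)"
    using cong_scalar_right[of "a * b" 1 "int p" c] by (simp add: mult.assoc)
  then show thesis by (rule that)
qed

text \<open>The Legendre symbol of -3 modulo p, and also the residue 1 or -1 of p modulo 6.\<close>

definition eps :: int where "eps = (if p mod 3 = 1 then 1 else - 1)"

lemma mod3_cases:
  obtains n where "p div 3 = n" "p = 3 * n + 1" "eps = 1"
  | n where "p div 3 = n" "p = 3 * n + 2" "eps = - 1"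
proof -
  have "\<not> 3 dvd p" using prime gt primes_dvd_imp_eq[of 3 p] by auto
  then have "p mod 3 = 1 \<or> p mod 3 = 2" by presburger
  then show thesis
  proof
    assume "p mod 3 = 1"
    then show thesis using that(1)[of "p div 3"] div_mult_mod_eq[of p 3] by (simp add: eps_def)
  next
    assume "p mod 3 = 2"
    then show thesis using that(2)[of "p div 3"] div_mult_mod_eq[of p 3] by (simp add: eps_def)
  qed
qed

text \<open>At x = -1 the discriminant x^2 - 4 is -3 and \<gamma> is a primitive cube root of unity,
  so U_p depends only on p modulo 3. This yields the character of -3 without quadratic
  reciprocity.\<close>

lemma minus_three_power: "[(- 3) ^ ((p - 1) div 2) = eps] (mod int p)"
proof -
  have "[lucas_U (- 1) p = (- 3) ^ ((p - 1) div 2)] (mod int p)"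
    using lucas_U_prime[of p "- 1"] prime gt by simp
  moreover have "lucas_U (- 1) p = eps"
  proof (cases rule: mod3_cases)
    case (1 n)
    with lucas_U_minus_one[of n] show ?thesis by simp
  next
    case (2 n)
    with lucas_U_minus_one[of n] show ?thesis by simp
  qed
  ultimately show ?thesis by (simp add: cong_sym)
qed

lemma QuadRes_power:
  assumes "QuadRes (int p) a" "\<not> int p dvd a"
  shows "[a ^ ((p - 1) div 2) = 1] (mod int p)"
  using euler_criterion[of p a] prime gt assms by (simp add: Legendre_def cong_0_iff cong_sym)

lemma not_QuadRes_power:
  assumes "\<not> QuadRes (int p) a" "\<not> int p dvd a"
  shows "[a ^ ((p - 1) div 2) = - 1] (mod int p)"
  using euler_criterion[of p a] prime gt assms by (simp add: Legendre_def cong_0_iff cong_sym)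

lemma discriminant_power:
  assumes "\<not> int p dvd a"
  shows "[a ^ ((p - 1) div 2) = (if QuadRes (int p) (- 3 * a) then eps else - eps)] (mod int p)"
proof -
  let ?h = "(p - 1) div 2"
  have nd: "\<not> int p dvd - 3 * a" using assms by (simp add: dvd_mult_iff)
  have "[(- 3 * a) ^ ?h = (if QuadRes (int p) (- 3 * a) then 1 else - 1)] (mod int p)"
    using QuadRes_power[OF _ nd] not_QuadRes_power[OF _ nd] by simp
  moreover have "[(- 3 * a) ^ ?h = eps * a ^ ?h] (mod int p)"
    unfolding power_mult_distrib by (intro cong_scalar_right minus_three_power)
  ultimately have "[eps * a ^ ?h = (if QuadRes (int p) (- 3 * a) then 1 else - 1)] (mod int p)"
    using cong_sym cong_trans by blast
  \<comment> \<open>The square of \<open>eps\<close> is 1, so multiplying once more by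
    \<open>eps\<close> isolates the power of a.\<close>
  then have "[eps * (eps * a ^ ?h) = eps * (if QuadRes (int p) (- 3 * a) then 1 else - 1)] (mod int p)"
    by (rule cong_scalar_left)
  then show ?thesis by (auto simp: eps_def split: if_splits)
qed

text \<open>The index 3 [p/3] + 1 is p or p - 1, so the quotient is a combination of U_p and V_p,
  whose residues are the character of v (v - 4) and v - 2. The dependence on p modulo 3 cancels
  against \<open>eps\<close>.\<close>

lemma lucas_B_prime:
  assumes "\<not> int p dvd v" "\<not> int p dvd v - 4"
  shows "[lucas_B (v - 2) (3 * (p div 3) + 1)
     = (if QuadRes (int p) (- 3 * (v * (v - 4))) then v - 3 else 1)] (mod int p)"
proof -
  define x where "x = v - 2"
  define d where "d = (if QuadRes (int p) (- 3 * (v * (v - 4))) then eps else - eps)"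
  have D: "x\<^sup>2 - 4 = v * (v - 4)" by (simp add: x_def power2_eq_square algebra_simps)
  have nD: "\<not> int p dvd v * (v - 4)" using assms by (simp add: dvd_mult_iff)
  then have "x\<^sup>2 \<noteq> 4" using D by (metis diff_self dvd_0_right)
  then have "[lucas_U x p = (v * (v - 4)) ^ ((p - 1) div 2)] (mod int p)"
    using lucas_U_prime[of p x] prime gt by (simp add: D)
  then have U: "[lucas_U x p = d] (mod int p)"
    using discriminant_power[OF nD] cong_trans unfolding d_def by blast
  have V: "[lucas_V x p = x] (mod int p)" using lucas_V_prime[of p x] prime gt by simp
  have "[2 * lucas_B x (3 * (p div 3) + 1) = 2 * (if QuadRes (int p) (- 3 * (v * (v - 4))) then v - 3 else 1)] (mod int p)"
  proof (cases rule: mod3_cases)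
    case (1 n)
    have "2 * lucas_B x p = x * lucas_U x p + lucas_V x p - 2 * lucas_U x p"
      unfolding lucas_B_def right_diff_distrib lucas_U_Suc ..
    also have "[\<dots> = x * d + x - 2 * d] (mod int p)"
      by (intro cong_add cong_diff cong_scalar_left U V)
    finally show ?thesis using 1 by (auto simp: d_def x_def algebra_simps)
  next
    case (2 n)
    obtain q where q: "p = Suc q" using gt by (cases p) auto
    have "2 * lucas_B x q = 2 * lucas_U x p - x * lucas_U x p + lucas_V x p"
      unfolding lucas_B_def lucas_V_def q by (simp add: algebra_simps)
    also have "[\<dots> = 2 * d - x * d + x] (mod int p)"
      by (intro cong_add cong_diff cong_scalar_left U V)
    finally show ?thesis using 2 q by (auto simp: d_def x_def algebra_simps)
  qed
  then show ?thesis unfolding x_def by (rule cong_cancel[rotated]) simp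
qed

end

section \<open>The normalized cubic\<close>

definition cubic :: "int \<Rightarrow> int \<Rightarrow> int" where
  "cubic u t = u * t ^ 3 - 3 * t - 1"

lemma cubic_dvd_cong:
  assumes "[s = t] (mod m)"
  shows "m dvd cubic u s \<longleftrightarrow> m dvd cubic u t"
  using assms unfolding cubic_def
  by (intro cong_dvd_iff cong_diff cong_mult cong_pow cong_refl)

text \<open>Dividing out the factor s - t leaves the quadratic u s^2 + u t s + u t^2 - 3; the factor
  4 u completes the square.\<close>

lemma cubic_diff:
  "4 * u * (cubic u s - cubic u t)
    = (s - t) * ((2 * u * s + u * t)\<^sup>2 - 3 * u * (4 - u * t\<^sup>2))"
  by (simp add: cubic_def power2_eq_square power3_eq_cube algebra_simps)

text \<open>At a root t, the quadratic factor has discriminant 3 u (4 - u t^2). The identity says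
  that it agrees with -3 u (u - 4) up to the square of t / (2 t + 1).\<close>

lemma cubic_discriminant:
  "(2 * t + 1)\<^sup>2 * (3 * u * (4 - u * t\<^sup>2)) = - 3 * (u * (u - 4)) * t\<^sup>2 + cubic u t * (- 12 * u * t - 12 * u)"
  by (simp add: cubic_def power2_eq_square power3_eq_cube algebra_simps)

context prime_gt_three
begin

text \<open>The cubic takes the values -1 at 0, u - 4 at 1 and (4 - u) / 8 at -1/2; the cofactors
  are Bezout certificates for this. The derivative at a root is 3 (u t^2 - 1), and t times it is 3
  (2 t + 1), so the second and the fourth fact both say that the root is simple.\<close>

lemma cubic_root_facts:
  assumes u: "\<not> int p dvd u - 4" and t: "int p dvd cubic u t"
  shows "\<not> int p dvd t" "\<not> int p dvd 2 * t + 1" "\<not> int p dvd t - 1" "\<not> int p dvd u * t\<^sup>2 - 1"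
proof -
  show "\<not> int p dvd t"
  proof
    assume "int p dvd t"
    then have "int p dvd 1" by (rule dvd_lincomb[OF _ t, where c = "u * t\<^sup>2 - 3" and d = "-1"]) (simp add: cubic_def power2_eq_square power3_eq_cube algebra_simps)
    then show False using not_dvd_1 by blast
  qed
  show 2: "\<not> int p dvd 2 * t + 1"
  proof
    assume "int p dvd 2 * t + 1"
    then have "int p dvd u - 4"
      by (rule dvd_lincomb[OF _ t, where c = "u * (4 * t\<^sup>2 - 2 * t + 1) - 12" and d = "-8"]) (simp add: cubic_def power2_eq_square power3_eq_cube algebra_simps)
    then show False using u by simp
  qed
  show "\<not> int p dvd t - 1"
  proof
    assume "int p dvd t - 1"
    then have "int p dvd u - 4"
      by (rule dvd_lincomb[OF _ t, where c = "- u * (t\<^sup>2 + t + 1) + 3" and d = "1"]) (simp add: cubic_def power2_eq_square power3_eq_cube algebra_simps)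
    then show False using u by simp
  qed
  show "\<not> int p dvd u * t\<^sup>2 - 1"
  proof
    assume "int p dvd u * t\<^sup>2 - 1"
    then have "int p dvd 2 * t + 1"
      by (rule dvd_lincomb[OF _ t, where c = "t" and d = "- 1"]) (simp add: cubic_def power2_eq_square power3_eq_cube algebra_simps)
    then show False using 2 by simp
  qed
qed

text \<open>The discriminant of \<open>cubic u\<close> is -27 u (u - 4), which differs from the
  tested number by the square 9.\<close>

definition split_disc :: "int \<Rightarrow> bool" where
  "split_disc u \<longleftrightarrow> QuadRes (int p) (- 3 * (u * (u - 4)))"

definition sol :: "int \<Rightarrow> int" where
  "sol u = lucas_B (u - 2) (p div 3)"

lemma sol_cubic:
  assumes "\<not> int p dvd u" "\<not> int p dvd u - 4"
  shows "[u * sol u ^ 3 - 3 * sol u = (if split_disc u then u - 3 else 1)] (mod int p)"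
  using lucas_B_prime[OF assms] lucas_B_triple[of "u - 2" "p div 3"]
  unfolding split_disc_def sol_def by simp

lemma sol_root_iff:
  assumes "\<not> int p dvd u" "\<not> int p dvd u - 4"
  shows "int p dvd cubic u (sol u) \<longleftrightarrow> \<not> split_disc u"
proof -
  have "cubic u (sol u) = (u * sol u ^ 3 - 3 * sol u) - 1" by (simp add: cubic_def)
  moreover have "[(u * sol u ^ 3 - 3 * sol u) - 1 = (if split_disc u then u - 3 else 1) - 1] (mod int p)"
    by (intro cong_diff sol_cubic assms cong_refl)
  ultimately have "int p dvd cubic u (sol u) \<longleftrightarrow> int p dvd (if split_disc u then u - 3 else 1) - 1"
    by (simp only: cong_dvd_iff)
  then show ?thesis using assms by simp
qed

text \<open>Composition with tripling gives s = t B, where B is the quotient for v = u t^2 at index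
  p or p - 1. Its residue v - 3 yields s = t (v - 3) = 1; the other residue 1 would make s = t a
  root, which a square discriminant excludes.\<close>

lemma sol_eq_one:
  assumes u: "\<not> int p dvd u" "\<not> int p dvd u - 4" and d: "split_disc u" and t: "int p dvd cubic u t"
  shows "[sol u = 1] (mod int p)"
proof -
  \<comment> \<open>By u t^3 - 3 t = 1, the element w = t (b + b^-1) satisfies w^3 - 3 w = b + b^-1.
    Hence w = \<delta> + \<delta>^-1 with \<delta>^3 = b up to inversion, and v = w^2 is to \<delta>
    what u is to b.\<close>
  define v where "v = u * t\<^sup>2"
  define x where "x = v - 2"
  define B where "B = lucas_B x (3 * (p div 3) + 1)"
  note facts = cubic_root_facts[OF u(2) t]
  have v: "\<not> int p dvd v" using u facts by (simp add: v_def dvd_mult_iff dvd_power_iff)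
  have v4: "\<not> int p dvd v - 4"
  proof
    assume "int p dvd v - 4"
    then have "int p dvd t - 1"
      by (rule dvd_lincomb[OF _ t, where c = "- t" and d = "1"]) (simp add: v_def cubic_def power2_eq_square power3_eq_cube algebra_simps)
    then show False using facts by simp
  qed
  have tv: "[t * (v - 3) = 1] (mod int p)"
    unfolding cong_iff_dvd_diff by (rule dvd_lincomb1[OF t, where c = 1]) (simp add: v_def cubic_def power2_eq_square power3_eq_cube algebra_simps)
  have "[x ^ 3 - 3 * x = u - 2] (mod int p)"
    unfolding cong_iff_dvd_diff
    by (rule dvd_lincomb1[OF t, where c = "u * (u * t ^ 3 - 3 * t + 1)"]) (simp add: v_def x_def cubic_def power2_eq_square power3_eq_cube algebra_simps)
  then have "[lucas_B (x ^ 3 - 3 * x) (p div 3) = sol u] (mod int p)"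
    unfolding sol_def by (rule lucas_B_cong)
  then have "[t * (v - 3) * lucas_B (x ^ 3 - 3 * x) (p div 3) = 1 * sol u] (mod int p)"
    by (intro cong_mult tv)
  moreover have "B = (v - 3) * lucas_B (x ^ 3 - 3 * x) (p div 3)"
    unfolding B_def lucas_B_comp_three[symmetric] x_def by simp
  ultimately have tB: "[t * B = sol u] (mod int p)" by (simp add: mult.assoc)
  have B: "[B = (if split_disc v then v - 3 else 1)] (mod int p)"
    unfolding B_def x_def split_disc_def by (rule lucas_B_prime[OF v v4])
  have "[t * B = t * (if split_disc v then v - 3 else 1)] (mod int p)"
    by (intro cong_scalar_left B)
  with tB have s: "[sol u = t * (if split_disc v then v - 3 else 1)] (mod int p)"
    using cong_sym cong_trans by blast
  show ?thesis
  proof (cases "split_disc v")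
    case True
    with s tv show ?thesis by (auto intro: cong_trans)
  next
    case False
    with s have "[sol u = t] (mod int p)" by simp
    then have "int p dvd cubic u (sol u)" using t cubic_dvd_cong by blast
    with d u show ?thesis using sol_root_iff by blast
  qed
qed

text \<open>A second root s makes the discriminant of the quadratic factor a square; the resulting
  square root of -3 u (u - 4) is (2 t + 1) (2 u s + u t) / t.\<close>

lemma second_root_disc:
  assumes u: "\<not> int p dvd u" "\<not> int p dvd u - 4"
    and t: "int p dvd cubic u t" and s: "int p dvd cubic u s" and ne: "\<not> int p dvd s - t"
  shows "split_disc u"
proof -
  note facts = cubic_root_facts[OF u(2) t]
  have "int p dvd (s - t) * ((2 * u * s + u * t)\<^sup>2 - 3 * u * (4 - u * t\<^sup>2))"
    unfolding cubic_diff[symmetric] by (intro dvd_mult dvd_diff s t)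
  then have 1: "int p dvd (2 * u * s + u * t)\<^sup>2 - 3 * u * (4 - u * t\<^sup>2)"
    using ne by (simp add: dvd_mult_iff)
  have 2: "int p dvd ((2 * t + 1) * (2 * u * s + u * t))\<^sup>2 - (- 3 * (u * (u - 4))) * t\<^sup>2"
    by (rule dvd_lincomb[OF 1 t, where c = "(2 * t + 1)\<^sup>2" and d = "- 12 * u * t - 12 * u"])
      (use cubic_discriminant[of t u] in \<open>simp add: power_mult_distrib right_diff_distrib mult.commute\<close>)
  obtain i where i: "[t * i = 1] (mod int p)" using inverse_mod facts(1) by blast
  have "[((2 * t + 1) * (2 * u * s + u * t))\<^sup>2 * i\<^sup>2 = (- 3 * (u * (u - 4))) * t\<^sup>2 * i\<^sup>2] (mod int p)"
    using 2 by (intro cong_scalar_right) (simp add: cong_iff_dvd_diff)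
  also have "(- 3 * (u * (u - 4))) * t\<^sup>2 * i\<^sup>2 = (- 3 * (u * (u - 4))) * (t * i)\<^sup>2"
    by (simp add: power_mult_distrib)
  also have "[\<dots> = (- 3 * (u * (u - 4))) * 1\<^sup>2] (mod int p)"
    by (intro cong_scalar_left cong_pow i)
  finally show ?thesis unfolding split_disc_def QuadRes_def power_mult_distrib[symmetric] by auto
qed

text \<open>The quadratic formula for the factor left after removing t. From a square root y of -3 u
  (u - 4), the number w = y t / (2 t + 1) is a square root of its discriminant.\<close>

lemma three_roots:
  assumes u: "\<not> int p dvd u" "\<not> int p dvd u - 4"
    and t: "int p dvd cubic u t" and d: "split_disc u"
  shows "\<exists>t1 t2. \<not> int p dvd t1 - t \<and> \<not> int p dvd t2 - t \<and> \<not> int p dvd t1 - t2 \<and>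
    (\<forall>s. int p dvd cubic u s \<longleftrightarrow> int p dvd s - t \<or> int p dvd s - t1 \<or> int p dvd s - t2)"
proof -
  note facts = cubic_root_facts[OF u(2) t]
  obtain y where y: "[y\<^sup>2 = - 3 * (u * (u - 4))] (mod int p)"
    using d unfolding split_disc_def QuadRes_def by blast
  obtain w where w: "[(2 * t + 1) * w = y * t] (mod int p)"
    using inverse_mod facts(2) by blast
  have nu: "\<not> int p dvd 2 * u" using u by (simp add: dvd_mult_iff)
  have w2: "int p dvd w\<^sup>2 - 3 * u * (4 - u * t\<^sup>2)"
  proof -
    have "[((2 * t + 1) * w)\<^sup>2 = (y * t)\<^sup>2] (mod int p)" by (intro cong_pow w)
    also have "(y * t)\<^sup>2 = y\<^sup>2 * t\<^sup>2" by (simp add: power_mult_distrib)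
    also have "[y\<^sup>2 * t\<^sup>2 = - 3 * (u * (u - 4)) * t\<^sup>2] (mod int p)" by (intro cong_scalar_right y)
    finally have 1: "int p dvd ((2 * t + 1) * w)\<^sup>2 - - 3 * (u * (u - 4)) * t\<^sup>2" by (simp add: cong_iff_dvd_diff)
    have "(2 * t + 1)\<^sup>2 * (w\<^sup>2 - 3 * u * (4 - u * t\<^sup>2))
        = ((2 * t + 1) * w)\<^sup>2 - (2 * t + 1)\<^sup>2 * (3 * u * (4 - u * t\<^sup>2))"
      by (simp only: power_mult_distrib right_diff_distrib)
    also have "\<dots> = 1 * (((2 * t + 1) * w)\<^sup>2 - - 3 * (u * (u - 4)) * t\<^sup>2) + (12 * u * t + 12 * u) * cubic u t"
      unfolding cubic_discriminant by (simp add: algebra_simps)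
    finally have "int p dvd (2 * t + 1)\<^sup>2 * (w\<^sup>2 - 3 * u * (4 - u * t\<^sup>2))"
      by (rule dvd_lincomb[OF 1 t])
    then show ?thesis using facts(2) by (simp add: dvd_mult_iff dvd_power_iff)
  qed
  have w0: "\<not> int p dvd w"
  proof
    assume "int p dvd w"
    then have "int p dvd y * t" using w cong_dvd_iff dvd_mult by blast
    then have "int p dvd y\<^sup>2" using facts(1) by (simp add: dvd_mult_iff dvd_power_iff)
    then have "int p dvd - 3 * (u * (u - 4))" using y cong_dvd_iff by blast
    then show False using u by (simp add: dvd_mult_iff)
  qed
  obtain t1 where t1: "[2 * u * t1 = - (u * t) + w] (mod int p)" using inverse_mod nu by blast
  obtain t2 where t2: "[2 * u * t2 = - (u * t) - w] (mod int p)" using inverse_mod nu by blast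
  have q: "int p dvd (2 * u * s + u * t)\<^sup>2 - 3 * u * (4 - u * t\<^sup>2) \<longleftrightarrow> int p dvd s - t1 \<or> int p dvd s - t2" for s
  proof -
    have "int p dvd (2 * u * s + u * t)\<^sup>2 - 3 * u * (4 - u * t\<^sup>2) \<longleftrightarrow> int p dvd (2 * u * s + u * t)\<^sup>2 - w\<^sup>2"
      using w2 by (intro cong_dvd_iff cong_diff cong_refl) (simp add: cong_iff_dvd_diff dvd_diff_commute)
    also have "(2 * u * s + u * t)\<^sup>2 - w\<^sup>2 = (2 * u * s - (- (u * t) + w)) * (2 * u * s - (- (u * t) - w))"
      by (simp add: power2_eq_square algebra_simps)
    also have "int p dvd \<dots> \<longleftrightarrow> int p dvd 2 * u * s - (- (u * t) + w) \<or> int p dvd 2 * u * s - (- (u * t) - w)"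
      by (rule dvd_mult_iff)
    also have "int p dvd 2 * u * s - (- (u * t) + w) \<longleftrightarrow> int p dvd 2 * u * s - 2 * u * t1"
      by (rule cong_dvd_iff[OF cong_diff[OF cong_refl cong_sym[OF t1]]])
    also have "int p dvd 2 * u * s - (- (u * t) - w) \<longleftrightarrow> int p dvd 2 * u * s - 2 * u * t2"
      by (rule cong_dvd_iff[OF cong_diff[OF cong_refl cong_sym[OF t2]]])
    finally show ?thesis using nu by (simp only: right_diff_distrib[symmetric] dvd_mult_iff simp_thms)
  qed
  have iff: "int p dvd cubic u s \<longleftrightarrow> int p dvd s - t \<or> int p dvd s - t1 \<or> int p dvd s - t2" for s
  proof -
    have "int p dvd cubic u s \<longleftrightarrow> int p dvd cubic u s - cubic u t"
      using t by (metis diff_add_cancel dvd_add_left_iff)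
    also have "\<dots> \<longleftrightarrow> int p dvd 4 * u * (cubic u s - cubic u t)"
      using u by (simp only: dvd_mult_iff not_dvd_4 simp_thms)
    finally show ?thesis unfolding cubic_diff dvd_mult_iff q .
  qed
  \<comment> \<open>The value of the quadratic factor at t itself is 4 u times the derivative of the
    cubic, nonzero because t is a simple root.\<close>
  have nt: "\<not> int p dvd (2 * u * t + u * t)\<^sup>2 - 3 * u * (4 - u * t\<^sup>2)"
  proof -
    have "(2 * u * t + u * t)\<^sup>2 - 3 * u * (4 - u * t\<^sup>2) = 3 * (4 * (u * (u * t\<^sup>2 - 1)))"
      by (simp add: power2_eq_square algebra_simps)
    then show ?thesis using u facts(4) by (simp only: dvd_mult_iff not_dvd_3 not_dvd_4 simp_thms)
  qed
  have t12: "\<not> int p dvd t1 - t2"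
  proof
    assume "int p dvd t1 - t2"
    then have "int p dvd 2 * u * t1 - 2 * u * t2" by (simp only: right_diff_distrib[symmetric] dvd_mult)
    moreover have "[2 * u * t1 - 2 * u * t2 = (- (u * t) + w) - (- (u * t) - w)] (mod int p)"
      by (intro cong_diff t1 t2)
    ultimately have "int p dvd 2 * w" using cong_dvd_iff by fastforce
    then show False using w0 by (simp add: dvd_mult_iff)
  qed
  from nt t12 iff show ?thesis unfolding q by (metis dvd_diff_commute)
qed

end

section \<open>Completely split cubics\<close>

lemma lucas_U_poly:
  "\<exists>f. degree f = n \<and> lead_coeff f = 1 \<and> (\<forall>x. poly f x = lucas_U x (Suc n))"
proof (induction n rule: induct_nat_012)
  case 0
  show ?case by (rule exI[of _ 1]) simp
next
  case 1
  show ?case by (rule exI[of _ "[:0, 1:]"]) simp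
next
  case (ge2 n)
  obtain f g where f: "degree f = n" "\<forall>x. poly f x = lucas_U x (Suc n)"
    and g: "degree g = Suc n" "lead_coeff g = 1" "\<forall>x. poly g x = lucas_U x (Suc (Suc n))"
    using ge2 by blast
  have "g \<noteq> 0" using g by auto
  have deg: "degree (pCons 0 g + - f) = Suc (Suc n)"
    using f(1) g(1) \<open>g \<noteq> 0\<close> by (subst degree_add_eq_left) simp_all
  then have "lead_coeff (pCons 0 g + - f) = 1"
    using f(1) g by (simp add: coeff_eq_0)
  moreover have "\<forall>x. poly (pCons 0 g + - f) x = lucas_U x (Suc (Suc (Suc n)))"
    using f(2) g(3) by simp
  ultimately show ?case using deg by blast
qed

context prime_gt_three
begin

text \<open>Lagrange's bound, by splitting off x - a. Integer polynomials with leading coefficient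
  prime to p avoid polynomials over the residue field.\<close>

lemma card_roots_le:
  fixes f :: "int poly"
  assumes "\<not> int p dvd lead_coeff f"
  shows "card {x \<in> {0..<p}. int p dvd poly f (int x)} \<le> degree f"
  using assms
proof (induction "degree f" arbitrary: f)
  case 0
  then obtain c where "f = [:c:]" by (metis degree_eq_zeroE)
  then show ?case using 0 by simp
next
  case (Suc n)
  show ?case
  proof (cases "\<exists>a\<in>{0..<p}. int p dvd poly f (int a)")
    case False
    then have "{x \<in> {0..<p}. int p dvd poly f (int x)} = {}" by blast
    then show ?thesis by (metis card.empty zero_le)
  next
    case True
    then obtain a where a: "a < p" "int p dvd poly f (int a)" by auto
    define q where "q = synthetic_div f (int a)"
    have deg: "degree q = n" unfolding q_def degree_synthetic_div using Suc(2) by simp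
    have f: "f + Polynomial.smult (int a) q = pCons (poly f (int a)) q"
      unfolding q_def by (rule synthetic_div_correct)
    have "Polynomial.coeff (f + Polynomial.smult (int a) q) (Suc n) = Polynomial.coeff q n" unfolding f by simp
    then have "lead_coeff q = lead_coeff f" using Suc(2) deg by (simp add: coeff_eq_0)
    then have "card {x \<in> {0..<p}. int p dvd poly q (int x)} \<le> n"
      using Suc(1)[of q] Suc(3) deg by simp
    moreover
    have "{x \<in> {0..<p}. int p dvd poly f (int x)}
        \<subseteq> insert a {x \<in> {0..<p}. int p dvd poly q (int x)}"
    proof
      fix x assume "x \<in> {x \<in> {0..<p}. int p dvd poly f (int x)}"
      then have x: "x < p" "int p dvd poly f (int x)" by auto
      have "poly f (int x) + int a * poly q (int x) = poly f (int a) + int x * poly q (int x)"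
        using arg_cong[OF f, of "\<lambda>g. poly g (int x)"] by simp
      then have "poly f (int x) - poly f (int a) = (int x - int a) * poly q (int x)"
        by (simp add: algebra_simps)
      then have "int p dvd (int x - int a) * poly q (int x)" using a x by (metis dvd_diff)
      then have "int p dvd int x - int a \<or> int p dvd poly q (int x)" by (simp only: dvd_mult_iff)
      moreover have "x = a" if "int p dvd int x - int a"
      proof -
        have "[x = a] (mod p)" using that by (simp add: cong_iff_dvd_diff flip: cong_int_iff)
        then show "x = a" using x a cong_less_modulus_unique_nat by blast
      qed
      ultimately show "x \<in> insert a {x \<in> {0..<p}. int p dvd poly q (int x)}" using x by auto
    qed
    then have "card {x \<in> {0..<p}. int p dvd poly f (int x)}
        \<le> card (insert a {x \<in> {0..<p}. int p dvd poly q (int x)})"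
      by (rule card_mono[rotated]) simp
    moreover have "\<dots> \<le> Suc (card {x \<in> {0..<p}. int p dvd poly q (int x)})"
      by (simp add: card_insert_if)
    ultimately show ?thesis using Suc(2) by linarith
  qed
qed

section \<open>Orders of \<gamma> and the consequence of s = 1\<close>

text \<open>A square discriminant makes the Frobenius send \<gamma> to \<gamma>^eps. As p - eps = 6
  h, this gives \<gamma>^(6h) = 1, an element of trace 2.\<close>

lemma lucas_V_period:
  assumes v: "\<not> int p dvd v" "\<not> int p dvd v - 4" and d: "split_disc v" and h: "int p = 6 * int h + eps"
  shows "[lucas_V (v - 2) (6 * h) = 2] (mod int p)"
proof -
  define x where "x = v - 2"
  have D: "x\<^sup>2 - 4 = v * (v - 4)" by (simp add: x_def power2_eq_square algebra_simps)
  have nD: "\<not> int p dvd v * (v - 4)" using v by (simp add: dvd_mult_iff)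
  then have "x\<^sup>2 \<noteq> 4" using D by (metis diff_self dvd_0_right)
  then have "[lucas_U x p = (v * (v - 4)) ^ ((p - 1) div 2)] (mod int p)"
    using lucas_U_prime[of p x] prime gt by (simp add: D)
  moreover have "[(v * (v - 4)) ^ ((p - 1) div 2) = eps] (mod int p)"
    using discriminant_power[OF nD] d unfolding split_disc_def by simp
  ultimately have U: "[lucas_U x p = eps] (mod int p)" using cong_trans by blast
  have V: "[lucas_V x p = x] (mod int p)" using lucas_V_prime[of p x] prime gt by simp
  have "2 * lucas_V x (6 * h) = x * lucas_V x p + (- eps) * ((x\<^sup>2 - 4) * lucas_U x p)"
  proof (cases rule: mod3_cases)
    case (1 n)
    with h have p: "p = Suc (6 * h)" by linarith
    have "2 * (2 * lucas_V x (6 * h)) = 2 * (x * lucas_V x p - (x\<^sup>2 - 4) * lucas_U x p)"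
    proof -
      have "2 * (x * lucas_V x p - (x\<^sup>2 - 4) * lucas_U x p)
        = x * (2 * lucas_V x p) - (x\<^sup>2 - 4) * (2 * lucas_U x p)" by (simp only: right_diff_distrib mult.left_commute)
      also have "\<dots> = 2 * (2 * lucas_V x (6 * h))"
        unfolding p lucas_V_Suc lucas_U_Suc by (simp add: algebra_simps power2_eq_square)
      finally show ?thesis ..
    qed
    then have "2 * lucas_V x (6 * h) = x * lucas_V x p - (x\<^sup>2 - 4) * lucas_U x p"
      by (rule mult_left_cancel[THEN iffD1, rotated]) simp
    then show ?thesis using 1 by simp
  next
    case (2 n)
    with h have "6 * h = Suc p" by linarith
    then show ?thesis using 2 lucas_V_Suc[of x p] by simp
  qed
  also have "[\<dots> = x * x + (- eps) * ((x\<^sup>2 - 4) * eps)] (mod int p)"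
    by (intro cong_add cong_scalar_left U V)
  also have "x * x + (- eps) * ((x\<^sup>2 - 4) * eps) = 2 * 2"
    by (simp add: eps_def power2_eq_square)
  finally show ?thesis unfolding x_def by (rule cong_cancel[rotated]) simp
qed

text \<open>Here \<gamma>^a = \<gamma>^(a+3) = 1, hence \<gamma>^3 = 1, while u \<noteq> 4 means
  \<gamma> \<noteq> 1. So \<gamma> is a primitive cube root of unity and u - 2 = -1.\<close>

lemma lucas_V_three_eq_two:
  assumes u: "\<not> int p dvd u" "\<not> int p dvd u - 4"
    and a: "[lucas_V (u - 2) a = 2] (mod int p)" and b: "[lucas_V (u - 2) (a + 3) = 2] (mod int p)"
  shows "int p dvd u - 1"
proof -
  define x where "x = u - 2"
  have D: "x\<^sup>2 - 4 = u * (u - 4)" by (simp add: x_def power2_eq_square algebra_simps)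
  have "(x\<^sup>2 - 4) * (lucas_U x a)\<^sup>2 = (lucas_V x a - 2) * (lucas_V x a + 2)"
    using lucas_V_norm[of x a] by (simp add: power2_eq_square algebra_simps)
  also have "int p dvd \<dots>" using a by (simp add: cong_iff_dvd_diff x_def)
  finally have "int p dvd lucas_U x a" unfolding D using u by (simp add: dvd_mult_iff dvd_power_iff)
  then have U: "[lucas_U x a = 0] (mod int p)" by (simp add: cong_0_iff)
  have V3: "lucas_V x 3 = x ^ 3 - 3 * x"
    using lucas_V_triple[of x 1] by (simp add: lucas_V_def)
  have "[2 * lucas_V x (a + 3) = 2 * lucas_V x 3 + (x\<^sup>2 - 4) * 0 * lucas_U x 3] (mod int p)"
    unfolding lucas_V_add using a U by (intro cong_add cong_mult cong_refl) (simp_all add: x_def)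
  then have "[2 * lucas_V x (a + 3) = 2 * lucas_V x 3] (mod int p)" by simp
  then have "[lucas_V x (a + 3) = lucas_V x 3] (mod int p)" by (rule cong_cancel[rotated]) simp
  from cong_trans[OF cong_sym[OF this] b[folded x_def]]
  have "[x ^ 3 - 3 * x = 2] (mod int p)" unfolding V3 .
  then have "int p dvd x ^ 3 - 3 * x - 2" unfolding cong_iff_dvd_diff .
  also have "x ^ 3 - 3 * x - 2 = (u - 4) * (u - 1)\<^sup>2"
    by (simp add: x_def power2_eq_square power3_eq_cube algebra_simps)
  finally show ?thesis using u by (simp add: dvd_mult_iff dvd_power_iff)
qed

lemma lucas_V_cube_two:
  assumes "[lucas_V x n = 2] (mod int p)"
  shows "[lucas_V x (3 * n) = 2] (mod int p)"
proof -
  have "[lucas_V x n ^ 3 - 3 * lucas_V x n = 2 ^ 3 - 3 * 2] (mod int p)"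
    by (intro cong_diff cong_pow cong_scalar_left assms)
  then show ?thesis unfolding lucas_V_triple by simp
qed

text \<open>The half-index factorization of s - 1 leaves either U_h = 0 or \<gamma>^(2k+1) = 1, with
  k = h or k = h - 1 according to p modulo 3. Cubing the latter gives an exponent 6 h + 3 or 6 h -
  3; compared with \<gamma>^(6h) = 1 it forces u = 1.\<close>

lemma lucas_U_eq_zero:
  assumes u: "\<not> int p dvd u" "\<not> int p dvd u - 4" "\<not> int p dvd u - 1" and d: "split_disc u"
    and h: "int p = 6 * int h + eps" and s: "[sol u = 1] (mod int p)"
  shows "int p dvd lucas_U (u - 2) h"
proof -
  define x where "x = u - 2"
  have x2: "x - 2 = u - 4" by (simp add: x_def)
  note period = lucas_V_period[OF u(1,2) d h, folded x_def]
  have two: "[lucas_V x (Suc (2 * k)) = 2] (mod int p)" if "int p dvd lucas_U x (Suc k) + lucas_U x k" for k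
    unfolding cong_iff_dvd_diff lucas_V_odd using that by (simp add: dvd_power_iff)
  show ?thesis
  proof (cases rule: mod3_cases)
    case (1 n)
    with h have n: "n = 2 * h" by linarith
    have "int p dvd (x - 2) * lucas_U x h * (lucas_U x (Suc h) + lucas_U x h)"
      unfolding lucas_B_even[symmetric] using s unfolding cong_iff_dvd_diff sol_def 1(1) n x_def .
    then have "int p dvd lucas_U x h \<or> int p dvd lucas_U x (Suc h) + lucas_U x h"
      using u unfolding x2 by (simp only: dvd_mult_iff simp_thms)
    moreover have False if "int p dvd lucas_U x (Suc h) + lucas_U x h"
    proof -
      have "[lucas_V x (6 * h + 3) = 2] (mod int p)"
        using lucas_V_cube_two[OF two[OF that]] by (simp add: algebra_simps)
      then show False using lucas_V_three_eq_two[OF u(1,2)] period u(3) unfolding x_def by blast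
    qed
    ultimately show ?thesis by (auto simp: x_def)
  next
    case (2 n)
    then have "h \<noteq> 0" using h by auto
    then obtain k where k: "h = Suc k" using not0_implies_Suc by blast
    have n: "n = Suc (2 * k)" using h 2 k by simp
    have "int p dvd (x - 2) * lucas_U x (Suc k) * (lucas_U x (Suc k) + lucas_U x k)"
      unfolding lucas_B_odd[symmetric] using s unfolding cong_iff_dvd_diff sol_def 2(1) n x_def .
    then have "int p dvd lucas_U x h \<or> int p dvd lucas_U x (Suc k) + lucas_U x k"
      using u unfolding x2 k by (simp only: dvd_mult_iff simp_thms)
    moreover have False if "int p dvd lucas_U x (Suc k) + lucas_U x k"
    proof -
      have "[lucas_V x (3 * Suc (2 * k)) = 2] (mod int p)"
        by (rule lucas_V_cube_two[OF two[OF that]])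
      moreover have "3 * Suc (2 * k) + 3 = 6 * h" using k by simp
      ultimately show False using lucas_V_three_eq_two[OF u(1,2), of "3 * Suc (2 * k)"] period u(3)
        unfolding x_def by metis
    qed
    ultimately show ?thesis by (auto simp: x_def)
  qed
qed

lemma exists_six_times:
  obtains h where "int p = 6 * int h + eps" "0 < h"
proof -
  have odd: "odd p" using prime gt prime_odd_nat by auto
  show thesis
  proof (cases rule: mod3_cases)
    case (1 n)
    with odd have "even n" by simp
    then obtain k where "n = 2 * k" by (rule evenE)
    with 1 gt that[of k] show thesis by simp
  next
    case (2 n)
    with odd have "odd n" by simp
    then obtain k where "n = 2 * k + 1" by (rule oddE)
    with 2 that[of "Suc k"] show thesis by simp
  qed
qed

section \<open>The split family and its count\<close>

lemma cyclotomic_root_eps: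
  assumes "int p dvd r\<^sup>2 + r + 1"
  shows "eps = 1"
proof -
  have "int p dvd (2 * r + 1)\<^sup>2 - (- 3)"
    by (rule dvd_lincomb1[OF assms, where c = 4]) (simp add: power2_eq_square algebra_simps)
  then have "QuadRes (int p) (- 3)" unfolding QuadRes_def cong_iff_dvd_diff by blast
  then have "[(- 3) ^ ((p - 1) div 2) = 1] (mod int p)" by (rule QuadRes_power) simp
  with minus_three_power have "[eps = 1] (mod int p)" using cong_sym cong_trans by blast
  then have "eps \<noteq> - 1" by (auto simp: cong_iff_dvd_diff)
  then show ?thesis by (simp add: eps_def split: if_splits)
qed

text \<open>The parametrization \<open>u = N / M\<^sup>3\<close> describes the \<open>u\<close> whose cubic splits completely. It arises
  from \<open>u - 2 = \<delta>\<^sup>3 + \<delta>\<^sup>-\<^sup>3\<close> with \<open>\<delta> = (r - \<omega>) / (r - \<omega>\<^sup>2)\<close> for a primitive cube root of unity \<open>\<omega>\<close>.\<close>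

definition param_M :: "int \<Rightarrow> int" where
  "param_M r = r\<^sup>2 + r + 1"

definition param_N :: "int \<Rightarrow> int" where
  "param_N r = ((2 * r + 1) * (r - 1) * (r + 2))\<^sup>2"

text \<open>For u = N / M^3 this makes -3 u (u - 4) a square, and it shows that u = 4 occurs only
  for r = 0 and r = -1 modulo p.\<close>

lemma param_N_minus: "param_N r - 4 * param_M r ^ 3 = - 27 * (r * (r + 1))\<^sup>2"
  by (simp add: param_N_def param_M_def power2_eq_square power3_eq_cube algebra_simps)

text \<open>The root is t = M / ((r - 1) (r + 2)), the ratio of \<delta>^(1/2) + \<delta>^(-1/2) to
  \<delta>^(3/2) + \<delta>^(-3/2).\<close>

lemma param_root:
  assumes "\<not> int p dvd u" and M: "\<not> int p dvd param_M r" and u: "int p dvd param_N r - u * param_M r ^ 3"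
  shows "\<exists>t. int p dvd cubic u t"
proof -
  define w where "w = (r - 1) * (r + 2)"
  have N: "param_N r = (2 * r + 1)\<^sup>2 * w\<^sup>2"
    by (simp add: param_N_def w_def power_mult_distrib)
  have w: "\<not> int p dvd w"
  proof
    assume "int p dvd w"
    then have "int p dvd param_N r" by (simp add: N dvd_mult_iff dvd_power_iff)
    with u have "int p dvd u * param_M r ^ 3" by (metis diff_diff_eq2 diff_self add_0 dvd_diff diff_0 add.commute add_diff_cancel_left')
    then show False using assms by (simp add: dvd_mult_iff dvd_power_iff)
  qed
  obtain t where t: "[w * t = param_M r] (mod int p)" using inverse_mod w by blast
  have "w ^ 3 * cubic u t = u * (w * t) ^ 3 - 3 * (w * t) * w\<^sup>2 - w ^ 3"
    by (simp add: cubic_def power2_eq_square power3_eq_cube algebra_simps)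
  also have "[\<dots> = u * param_M r ^ 3 - 3 * param_M r * w\<^sup>2 - w ^ 3] (mod int p)"
    by (intro cong_diff cong_mult cong_pow t cong_refl)
  also have "u * param_M r ^ 3 - 3 * param_M r * w\<^sup>2 - w ^ 3 = - (param_N r - u * param_M r ^ 3)"
    by (simp add: param_N_def param_M_def w_def power2_eq_square power3_eq_cube algebra_simps)
  also have "[- (param_N r - u * param_M r ^ 3) = 0] (mod int p)"
    using u by (simp only: cong_0_iff dvd_minus_iff)
  finally have "int p dvd w ^ 3 * cubic u t" by (simp only: cong_0_iff)
  then show ?thesis using w by (auto simp: dvd_mult_iff dvd_power_iff)
qed

text \<open>For v = (2 r + 1)^2 / M one has v - 2 = \<delta> + \<delta>^-1, and -3 v (v - 4) is the
  square of 3 (2 r + 1) / M. So \<delta>^(6h) = 1, and \<gamma> = \<delta>^3 satisfies \<gamma>^(2h)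
  = 1.\<close>

lemma param_lucas_U:
  assumes M: "\<not> int p dvd param_M r" and N: "\<not> int p dvd param_N r" and r: "\<not> int p dvd r * (r + 1)"
    and h: "int p = 6 * int h + eps" and u: "int p dvd param_N r - u * param_M r ^ 3"
  shows "int p dvd lucas_U (u - 2) h"
proof -
  define M where "M = param_M r"
  have nM: "\<not> int p dvd M" using assms(1) by (simp add: M_def)
  obtain i where i: "[M * i = 1] (mod int p)" using inverse_mod nM by blast
  define v where "v = (2 * r + 1)\<^sup>2 * i"
  have "M * v = (2 * r + 1)\<^sup>2 * (M * i)" by (simp add: v_def)
  also have "[\<dots> = (2 * r + 1)\<^sup>2 * 1] (mod int p)" by (intro cong_scalar_left i)
  finally have Mv: "[M * v = (2 * r + 1)\<^sup>2] (mod int p)" by simp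
  have "[M * v - 4 * M = (2 * r + 1)\<^sup>2 - 4 * M] (mod int p)" by (intro cong_diff Mv cong_refl)
  also have "(2 * r + 1)\<^sup>2 - 4 * M = - 3" by (simp add: M_def param_M_def power2_eq_square algebra_simps)
  finally have Mv4: "[M * (v - 4) = - 3] (mod int p)" by (simp add: algebra_simps)
  have "\<not> int p dvd (2 * r + 1)\<^sup>2" using N by (simp add: param_N_def dvd_mult_iff dvd_power_iff)
  then have v: "\<not> int p dvd v" using Mv cong_dvd_iff dvd_mult by blast
  have "\<not> int p dvd - 3" by simp
  then have v4: "\<not> int p dvd v - 4" using Mv4 cong_dvd_iff dvd_mult by blast
  have "[(M * (3 * (2 * r + 1) * i))\<^sup>2 = (3 * (2 * r + 1) * 1)\<^sup>2] (mod int p)"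
    using cong_pow[OF cong_scalar_left[OF i], of "3 * (2 * r + 1)" 2] by (simp only: mult.left_commute mult.assoc)
  also have "(3 * (2 * r + 1) * 1)\<^sup>2 = - 3 * ((2 * r + 1)\<^sup>2 * (- 3))" by (simp add: power2_eq_square algebra_simps)
  also have "[- 3 * ((2 * r + 1)\<^sup>2 * (- 3)) = - 3 * ((M * v) * (M * (v - 4)))] (mod int p)"
    by (intro cong_scalar_left cong_mult cong_sym[OF Mv] cong_sym[OF Mv4])
  also have "- 3 * ((M * v) * (M * (v - 4))) = M\<^sup>2 * (- 3 * (v * (v - 4)))"
    by (simp only: power2_eq_square mult_ac)
  also have "(M * (3 * (2 * r + 1) * i))\<^sup>2 = M\<^sup>2 * (3 * (2 * r + 1) * i)\<^sup>2" by (simp only: power_mult_distrib)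
  finally have "[M\<^sup>2 * (3 * (2 * r + 1) * i)\<^sup>2 = M\<^sup>2 * (- 3 * (v * (v - 4)))] (mod int p)" .
  then have "[(3 * (2 * r + 1) * i)\<^sup>2 = - 3 * (v * (v - 4))] (mod int p)"
    by (rule cong_cancel[rotated]) (simp add: nM dvd_power_iff)
  then have d: "split_disc v" unfolding split_disc_def QuadRes_def by blast
  define x where "x = v - 2"
  define y where "y = x ^ 3 - 3 * x"
  have y2: "y + 2 = v * (v - 3)\<^sup>2"
    by (simp add: y_def x_def power2_eq_square power3_eq_cube algebra_simps)
  have "[M * (v - 4) + M = - 3 + M] (mod int p)" by (intro cong_add Mv4 cong_refl)
  then have Mv3: "[M * (v - 3) = (r - 1) * (r + 2)] (mod int p)"
    by (simp add: M_def param_M_def power2_eq_square algebra_simps)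
  have "M ^ 3 * (y + 2) = (M * v) * (M * (v - 3))\<^sup>2"
    unfolding y2 by (simp add: power2_eq_square power3_eq_cube)
  also have "[\<dots> = (2 * r + 1)\<^sup>2 * ((r - 1) * (r + 2))\<^sup>2] (mod int p)"
    by (intro cong_mult cong_pow Mv Mv3)
  also have "(2 * r + 1)\<^sup>2 * ((r - 1) * (r + 2))\<^sup>2 = param_N r"
    by (simp add: param_N_def power_mult_distrib)
  also have N': "[param_N r = M ^ 3 * u] (mod int p)" using u by (simp add: cong_iff_dvd_diff M_def mult.commute)
  finally have "[M ^ 3 * (y + 2) = M ^ 3 * u] (mod int p)" .
  then have "[y + 2 = u] (mod int p)"
    by (rule cong_cancel[rotated]) (simp add: nM dvd_power_iff)
  from cong_diff[OF this cong_refl[of 2]] have yu: "[y = u - 2] (mod int p)" by simp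
  have "[lucas_V y (2 * h) = 2] (mod int p)"
    using lucas_V_period[OF v v4 d h] unfolding y_def lucas_V_comp_three x_def by simp
  then have 1: "int p dvd (y\<^sup>2 - 4) * (lucas_U y h)\<^sup>2"
    unfolding lucas_V_double by (simp add: cong_iff_dvd_diff)
  have "[y\<^sup>2 - 4 = (u - 2)\<^sup>2 - 4] (mod int p)" by (intro cong_diff cong_pow yu cong_refl)
  moreover have "(u - 2)\<^sup>2 - 4 = u * (u - 4)" by (simp add: power2_eq_square algebra_simps)
  moreover have "\<not> int p dvd u"
  proof
    assume "int p dvd u"
    then have "int p dvd M ^ 3 * u" by simp
    then show False using N' N cong_dvd_iff by blast
  qed
  moreover have "\<not> int p dvd u - 4"
  proof
    assume "int p dvd u - 4"
    then have "int p dvd param_N r - 4 * param_M r ^ 3"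
      by (rule dvd_lincomb[OF u, where c = 1 and d = "param_M r ^ 3"]) (simp add: algebra_simps)
    then show False unfolding param_N_minus using r by (simp add: dvd_mult_iff dvd_power_iff)
  qed
  ultimately have "\<not> int p dvd y\<^sup>2 - 4" using cong_dvd_iff dvd_mult_iff by metis
  with 1 have "int p dvd lucas_U y h" by (simp add: dvd_mult_iff dvd_power_iff)
  then show ?thesis using lucas_U_cong[OF yu] cong_dvd_iff by blast
qed

text \<open>At most 5 residues are excluded by N and r (r + 1), and at most 2 by M, the latter only
  if eps = 1. Both 6 h + 1 - 7 and 6 h - 1 - 5 equal 6 h - 6.\<close>

lemma card_param_ge:
  assumes h: "int p = 6 * int h + eps"
  shows "6 * h \<le> card {r \<in> {0..<p}. \<not> int p dvd param_M (int r) \<and> \<not> int p dvd param_N (int r) \<and>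
    \<not> int p dvd int r * (int r + 1)} + 6"
    (is "_ \<le> card ?A + 6")
proof -
  \<comment> \<open>The quintic is the expansion of (2 r + 1) (r - 1) (r + 2) r (r + 1).\<close>
  define F where "F = {r \<in> {0..<p}. int p dvd poly [:0, - 2, - 5, 0, 5, 2:] (int r)}"
  define G where "G = {r \<in> {0..<p}. int p dvd poly [:1, 1, 1:] (int r)}"
  have "card F \<le> degree [:0, - 2, - 5, 0, 5, 2 :: int:]"
    unfolding F_def by (rule card_roots_le) simp
  then have F: "card F \<le> 5" by simp
  have "card G \<le> degree [:1, 1, 1 :: int:]"
    unfolding G_def by (rule card_roots_le) (use gt in simp)
  then have G: "card G \<le> 2" by simp
  have M: "poly [:1, 1, 1:] r = param_M r" for r
    by (simp add: param_M_def power2_eq_square algebra_simps)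
  have G': "G = {}" if "eps \<noteq> 1"
    using that cyclotomic_root_eps unfolding G_def M param_M_def by blast
  have P: "poly [:0, - 2, - 5, 0, 5, 2:] r = (2 * r + 1) * (r - 1) * (r + 2) * (r * (r + 1))" for r :: int
    by (simp add: algebra_simps)
  have "{0..<p} \<subseteq> ?A \<union> (F \<union> G)"
    unfolding F_def G_def M P by (auto simp: param_N_def dvd_mult_iff dvd_power_iff)
  then have "card {0..<p} \<le> card (?A \<union> (F \<union> G))"
    by (rule card_mono[rotated]) (simp add: F_def G_def)
  also have "\<dots> \<le> card ?A + card (F \<union> G)" by (rule card_Un_le)
  also have "card (F \<union> G) \<le> card F + card G" by (rule card_Un_le)
  finally have "p \<le> card ?A + (card F + card G)" by simp
  then show ?thesis using F G G' h by (cases "eps = 1") (auto simp: eps_def split: if_splits)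
qed

text \<open>If u were missed, all admissible parameters would lie over the other zeros of U_h, at
  most h - 2 in number. With at most 6 parameters over each there would be at most 6 h - 12, fewer
  than the 6 h - 6 available.\<close>

lemma exists_param:
  assumes h: "int p = 6 * int h + eps" "0 < h" and U: "int p dvd lucas_U (u - 2) h"
  shows "\<exists>r. \<not> int p dvd param_M r \<and> int p dvd param_N r - u * param_M r ^ 3"
proof (rule ccontr)
  assume contra: "\<not> ?thesis"
  define A where "A = {r \<in> {0..<p}. \<not> int p dvd param_M (int r) \<and> \<not> int p dvd param_N (int r) \<and>
    \<not> int p dvd int r * (int r + 1)}"
  define B where "B = {y \<in> {0..<p}. int p dvd lucas_U (int y) h}"
  define F where "F y = {r \<in> A. int p dvd param_N (int r) - (int y + 2) * param_M (int r) ^ 3}" for y :: nat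
  define y0 where "y0 = nat ((u - 2) mod int p)"
  have y0: "y0 < p" "[int y0 = u - 2] (mod int p)"
    using gt by (simp_all add: y0_def nat_less_iff)
  obtain k where k: "h = Suc k" using h(2) gr0_implies_Suc by blast
  obtain f where f: "degree f = k" "lead_coeff f = 1" "\<forall>x. poly f x = lucas_U x h"
    using lucas_U_poly k by blast
  have "card {x \<in> {0..<p}. int p dvd poly f (int x)} \<le> degree f" by (rule card_roots_le) (use gt f(2) in simp)
  then have B: "card B \<le> k" using f by (simp add: B_def)
  have finB: "finite B" by (simp add: B_def)
  have y0B: "y0 \<in> B" using y0 U lucas_U_cong[OF y0(2)] cong_dvd_iff by (auto simp: B_def)
  have F: "card (F y) \<le> 6" for y
  \<comment> \<open>For v = y + 2 = 4 the sextic in r loses its leading coefficient 4 - v; there r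
    (r + 1) would vanish, so no admissible parameter exists.\<close>
  proof (cases "int p dvd int y + 2 - 4")
    case True
    have "F y = {}"
    proof (rule ccontr)
      assume "F y \<noteq> {}"
      then obtain r where r: "r \<in> A" "int p dvd param_N (int r) - (int y + 2) * param_M (int r) ^ 3"
        unfolding F_def by blast
      from True have "int p dvd param_N (int r) - 4 * param_M (int r) ^ 3"
        by (rule dvd_lincomb[OF r(2), where c = 1 and d = "param_M (int r) ^ 3"]) (simp add: algebra_simps)
      then show False using r(1) unfolding param_N_minus A_def by (simp add: dvd_mult_iff dvd_power_iff)
    qed
    then show ?thesis by simp
  next
    case False
    define v where "v = int y + 2"
    define g where "g = [:4 - v, 12 - 3 * v, - 3 - 6 * v, - 26 - 7 * v, - 3 - 6 * v, 12 - 3 * v, 4 - v:]"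
    have g: "poly g r = param_N r - v * param_M r ^ 3" for r
      by (simp add: g_def param_N_def param_M_def power2_eq_square power3_eq_cube algebra_simps)
    have nv: "\<not> int p dvd 4 - v" using False by (simp add: v_def dvd_diff_commute)
    then have "4 - v \<noteq> 0" by (metis dvd_0_right)
    then have lead: "degree g = 6" "lead_coeff g = 4 - v" by (simp_all add: g_def)
    have "card (F y) \<le> card {r \<in> {0..<p}. int p dvd poly g (int r)}"
      by (rule card_mono) (auto simp: F_def A_def g v_def)
    also have "\<dots> \<le> degree g" by (rule card_roots_le) (unfold lead(2), rule nv)
    also have "\<dots> = 6" by (rule lead(1))
    finally show ?thesis .
  qed
  have "A \<subseteq> (\<Union>y\<in>B - {y0}. F y)"
  proof
    fix r assume r: "r \<in> A"
    define M where "M = param_M (int r)"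
    have nM: "\<not> int p dvd M" using r by (simp add: A_def M_def)
    then obtain v where v: "[M ^ 3 * v = param_N (int r)] (mod int p)"
      using inverse_mod dvd_power_iff[of 3 M] by (metis zero_less_numeral)
    define y where "y = nat ((v - 2) mod int p)"
    have y: "y < p" "[int y = v - 2] (mod int p)"
      using gt by (simp_all add: y_def nat_less_iff)
    have "[M ^ 3 * (int y + 2) = M ^ 3 * (v - 2 + 2)] (mod int p)"
      by (intro cong_scalar_left cong_add y cong_refl)
    then have "[M ^ 3 * (int y + 2) = param_N (int r)] (mod int p)" using v by (auto intro: cong_trans)
    then have yN: "int p dvd param_N (int r) - (int y + 2) * param_M (int r) ^ 3"
      by (simp add: cong_iff_dvd_diff M_def dvd_diff_commute mult.commute)
    then have "int p dvd lucas_U (int y) h"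
      using param_lucas_U[of "int r" h "int y + 2"] r h(1) by (simp add: A_def)
    moreover have "y \<noteq> y0"
    proof
      assume "y = y0"
      then have "[int y + 2 = u - 2 + 2] (mod int p)" using y0 by (intro cong_add) simp_all
      then have "[int y + 2 = u] (mod int p)" by simp
      then have "[param_N (int r) - (int y + 2) * param_M (int r) ^ 3 = param_N (int r) - u * param_M (int r) ^ 3] (mod int p)"
        by (intro cong_diff cong_scalar_right cong_refl)
      then have "int p dvd param_N (int r) - u * param_M (int r) ^ 3" using yN cong_dvd_iff by blast
      then show False using contra nM unfolding M_def by blast
    qed
    ultimately show "r \<in> (\<Union>y\<in>B - {y0}. F y)" using y yN r by (auto simp: B_def F_def)
  qed
  then have "card A \<le> card (\<Union>y\<in>B - {y0}. F y)"
    by (rule card_mono[rotated]) (use finB in \<open>auto simp: F_def A_def\<close>)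
  also have "\<dots> \<le> (\<Sum>y\<in>B - {y0}. card (F y))" using finB by (intro card_UN_le) simp
  also have "\<dots> \<le> (\<Sum>y\<in>B - {y0}. 6)" by (intro sum_mono F)
  also have "\<dots> = 6 * (card B - 1)" using y0B finB by simp
  finally have "card A \<le> 6 * (card B - 1)" .
  moreover have "0 < card B" using y0B finB card_gt_0_iff by blast
  moreover have "6 * h \<le> card A + 6" unfolding A_def by (rule card_param_ge[OF h(1)])
  ultimately show False using B k by linarith
qed

lemma sol_eq_one_iff:
  assumes u: "\<not> int p dvd u" "\<not> int p dvd u - 1" "\<not> int p dvd u - 4"
  shows "[sol u = 1] (mod int p) \<longleftrightarrow> split_disc u \<and> (\<exists>t. int p dvd cubic u t)"
proof
  assume s: "[sol u = 1] (mod int p)"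
  have d: "split_disc u"
  proof (rule ccontr)
    assume "\<not> split_disc u"
    then have "int p dvd cubic u (sol u)" using sol_root_iff u by blast
    \<comment> \<open>The value of the cubic at 1 is u - 4, which is nonzero modulo p.\<close>
    then have "int p dvd cubic u 1" using s cubic_dvd_cong by blast
    then show False using u by (simp add: cubic_def)
  qed
  obtain h where h: "int p = 6 * int h + eps" "0 < h" by (rule exists_six_times)
  have "int p dvd lucas_U (u - 2) h" by (rule lucas_U_eq_zero[OF u(1,3,2) d h(1) s])
  then show "split_disc u \<and> (\<exists>t. int p dvd cubic u t)"
    using d exists_param[OF h] param_root u(1) by blast
qed (use sol_eq_one u in blast)

end

section \<open>The binomial sum\<close>

lemma binomial_step:
  assumes "k \<le> n"
  shows "(Suc n + k choose (2 * Suc k)) * ((2 * k + 2) * (2 * k + 1)) = ((n + k) choose (2 * k)) * ((n + k + 1) * (n - k))"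
proof -
  have "Suc (Suc (2 * k)) * (Suc (n + k) choose Suc (Suc (2 * k))) = Suc (n + k) * ((n + k) choose Suc (2 * k))"
    using binomial_absorption[of "Suc (2 * k)" "Suc (n + k)"] by simp
  moreover have "Suc (2 * k) * ((n + k) choose Suc (2 * k)) = (n - k) * ((n + k) choose (2 * k))"
    using binomial_absorption[of "2 * k" "n + k"] binomial_absorb_comp[of "n + k" "2 * k"] assms by simp
  moreover have "a * ((2 * k + 2) * (2 * k + 1)) = c * ((n + k + 1) * (n - k))"
    if "Suc (Suc (2 * k)) * a = Suc (n + k) * b" "Suc (2 * k) * b = (n - k) * c" for a b c :: nat
  proof -
    have "a * ((2 * k + 2) * (2 * k + 1)) = (Suc (Suc (2 * k)) * a) * Suc (2 * k)"
      by (simp only: add_2_eq_Suc' Suc_eq_plus1[symmetric] mult_ac)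
    also have "\<dots> = Suc (n + k) * (Suc (2 * k) * b)"
      unfolding that(1) by (simp only: mult_ac)
    finally show ?thesis unfolding that(2) by (simp only: Suc_eq_plus1 mult_ac)
  qed
  ultimately show ?thesis by (simp only: add_Suc mult_Suc_right add_2_eq_Suc)
qed

lemma binomial_triple_step:
  "((3 * Suc k) choose (Suc k)) * ((2 * k + 2) * (2 * k + 1)) = 3 * ((3 * k) choose k) * ((3 * k + 1) * (3 * k + 2))"
proof -
  define f g where "f = (fact k :: nat)" and "g = (fact (2 * k) :: nat)"
  have pos: "f * g * Suc k \<noteq> 0" by (simp add: f_def g_def)
  have 1: "f * g * ((3 * k) choose k) = fact (3 * k)"
    using binomial_fact_lemma[of k "3 * k"] by (simp add: f_def g_def)
  have "fact (Suc k) = Suc k * f" "fact (2 * Suc k) = (2 * k + 2) * ((2 * k + 1) * g)"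
    by (simp_all add: f_def g_def)
  moreover have sub: "3 * Suc k - Suc k = 2 * Suc k" and le: "Suc k \<le> 3 * Suc k" by simp_all
  ultimately have "(Suc k * f) * ((2 * k + 2) * ((2 * k + 1) * g)) * ((3 * Suc k) choose (Suc k)) = fact (3 * Suc k)"
    using binomial_fact_lemma[of "Suc k" "3 * Suc k"] unfolding sub by (simp only: le)
  also have "fact (3 * Suc k) = 3 * Suc k * ((3 * k + 2) * ((3 * k + 1) * fact (3 * k)))"
  proof -
    have e: "3 * Suc k = Suc (Suc (Suc (3 * k)))" by simp
    show ?thesis unfolding e fact_Suc by simp
  qed
  finally have "(f * g * Suc k) * (((3 * Suc k) choose (Suc k)) * ((2 * k + 2) * (2 * k + 1)))
      = (f * g * Suc k) * (3 * ((3 * k) choose k) * ((3 * k + 1) * (3 * k + 2)))"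
    unfolding 1[symmetric] by (simp only: mult_ac)
  then show ?thesis by (rule mult_left_cancel[THEN iffD1, OF pos])
qed

context prime_gt_three
begin

text \<open>Both sides have the same ratio of consecutive terms: for n = [p/3], -27 (n + k + 1) (n -
  k) and 3 (3 k + 1) (3 k + 2) differ by -3 (3 n + 1) (3 n + 2), a multiple of p.\<close>

lemma binomial_cong:
  assumes "k \<le> p div 3"
  shows "[(- 27) ^ k * int ((p div 3 + k) choose (2 * k)) = int ((3 * k) choose k)] (mod int p)"
  using assms
proof (induction k)
  case (Suc k)
  define n where "n = p div 3"
  have k: "k < n" using Suc.prems by (simp add: n_def)
  define b where "b = int ((n + k) choose (2 * k))"
  define b' where "b' = int ((n + Suc k) choose (2 * Suc k))"
  define c where "c = int ((3 * k) choose k)"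
  define c' where "c' = int ((3 * Suc k) choose (Suc k))"
  define d where "d = (2 * int k + 2) * (2 * int k + 1)"
  have IH: "[(- 27) ^ k * b = c] (mod int p)" using Suc by (simp add: b_def c_def n_def)
  have "int (((Suc n + k) choose (2 * Suc k)) * ((2 * k + 2) * (2 * k + 1)))
      = int (((n + k) choose (2 * k)) * ((n + k + 1) * (n - k)))"
    using binomial_step[of k n] k by simp
  moreover have nk: "int (n - k) = int n - int k" using k by simp
  ultimately have b': "b' * d = b * ((int n + int k + 1) * (int n - int k))"
    unfolding b'_def b_def d_def of_nat_mult of_nat_add nk add_Suc_shift by (simp only: of_nat_numeral of_nat_1)
  have "int (((3 * Suc k) choose (Suc k)) * ((2 * k + 2) * (2 * k + 1)))
      = int (3 * ((3 * k) choose k) * ((3 * k + 1) * (3 * k + 2)))"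
    by (simp only: binomial_triple_step)
  then have c': "c' * d = 3 * c * ((3 * int k + 1) * (3 * int k + 2))"
    unfolding c'_def c_def d_def of_nat_mult of_nat_add by (simp only: of_nat_numeral of_nat_1)
  have "p = 3 * n + 1 \<or> p = 3 * n + 2" unfolding n_def by (cases rule: mod3_cases) auto
  then have "int p = 3 * int n + 1 \<or> int p = 3 * int n + 2" by linarith
  then have pn: "int p dvd (3 * int n + 1) * (3 * int n + 2)" by auto
  have "[(- 27) * ((int n + int k + 1) * (int n - int k)) = 3 * ((3 * int k + 1) * (3 * int k + 2))] (mod int p)"
    unfolding cong_iff_dvd_diff
    by (rule dvd_lincomb1[OF pn, where c = "- 3"]) (simp add: algebra_simps)
  from cong_mult[OF IH this]
  have "[((- 27) ^ k * b) * ((- 27) * ((int n + int k + 1) * (int n - int k)))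
      = c * (3 * ((3 * int k + 1) * (3 * int k + 2)))] (mod int p)" .
  also have "((- 27) ^ k * b) * ((- 27) * ((int n + int k + 1) * (int n - int k)))
      = (- 27) ^ Suc k * (b * ((int n + int k + 1) * (int n - int k)))"
    by (simp only: power_Suc mult_ac)
  also have "\<dots> = d * ((- 27) ^ Suc k * b')"
    unfolding b'[symmetric] by (simp only: mult_ac)
  also have "c * (3 * ((3 * int k + 1) * (3 * int k + 2))) = 3 * c * ((3 * int k + 1) * (3 * int k + 2))"
    by (simp only: mult_ac)
  also have "\<dots> = d * c'"
    unfolding c'[symmetric] by (simp only: mult_ac)
  finally have "[d * ((- 27) ^ Suc k * b') = d * c'] (mod int p)" .
  \<comment> \<open>From k < [p/3] follows 2 k + 2 < p, so the common denominator of the two ratios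
    can be cancelled.\<close>
  moreover have "\<not> int p dvd d"
  proof -
    have "2 * n < p" unfolding n_def using gt by linarith
    then have "\<not> int p dvd 2 * int k + 2" "\<not> int p dvd 2 * int k + 1"
      using k not_dvd_small[of "2 * int k + 2"] not_dvd_small[of "2 * int k + 1"] by auto
    then show ?thesis by (simp add: d_def dvd_mult_iff)
  qed
  ultimately show ?case using cong_cancel unfolding b'_def c'_def n_def by blast
qed simp

lemma binomial_sum_cong_sol:
  assumes z: "[27 * z = 4 - u] (mod int p)"
  shows "[(\<Sum>k\<le>p div 3. int ((3 * k) choose k) * z ^ k) = sol u] (mod int p)"
proof -
  have "sol u = lucas_B ((u - 4) + 2) (p div 3)" by (simp add: sol_def)
  also have "\<dots> = (\<Sum>k\<le>p div 3. int ((p div 3 + k) choose (2 * k)) * (u - 4) ^ k)"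
    by (rule lucas_B_binomial)
  finally have sol: "sol u = (\<Sum>k\<le>p div 3. int ((p div 3 + k) choose (2 * k)) * (u - 4) ^ k)" .
  have z': "[- 27 * z = u - 4] (mod int p)" using cong_minus_minus_iff[of "27 * z" "4 - u" "int p"] z by simp
  show ?thesis unfolding sol
  proof (rule cong_sum)
    fix k assume "k \<in> {..p div 3}"
    then have k: "k \<le> p div 3" by simp
    have "[int ((3 * k) choose k) * z ^ k = (- 27) ^ k * int ((p div 3 + k) choose (2 * k)) * z ^ k] (mod int p)"
      by (intro cong_scalar_right cong_sym[OF binomial_cong[OF k]])
    also have "(- 27) ^ k * int ((p div 3 + k) choose (2 * k)) * z ^ k
        = int ((p div 3 + k) choose (2 * k)) * (- 27 * z) ^ k"
      by (simp only: power_mult_distrib mult_ac)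
    also have "[\<dots> = int ((p div 3 + k) choose (2 * k)) * (u - 4) ^ k] (mod int p)"
      by (intro cong_scalar_left cong_pow z')
    finally show "[int ((3 * k) choose k) * z ^ k = int ((p div 3 + k) choose (2 * k)) * (u - 4) ^ k] (mod int p)" .
  qed
qed

section \<open>Counting roots along an affine substitution\<close>

lemma affine_preimage:
  assumes "\<not> int p dvd m"
  shows "\<exists>g. (\<forall>a. g a < p) \<and> (\<forall>a. \<forall>x<p. int p dvd m * int x + k - a \<longleftrightarrow> x = g a)
    \<and> (\<forall>a b. g a = g b \<longrightarrow> int p dvd a - b)"
proof -
  obtain i where i: "[m * i = 1] (mod int p)" using inverse_mod assms by blast
  define g where "g a = nat ((i * (a - k)) mod int p)" for a
  have g: "g a < p" "[int (g a) = i * (a - k)] (mod int p)" for a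
    using gt by (simp_all add: g_def nat_less_iff)
  have mg: "[m * int (g a) = a - k] (mod int p)" for a
  proof -
    have "[m * int (g a) = m * (i * (a - k))] (mod int p)" by (intro cong_scalar_left g)
    also have "m * (i * (a - k)) = (m * i) * (a - k)" by simp
    also have "[(m * i) * (a - k) = 1 * (a - k)] (mod int p)" by (intro cong_scalar_right i)
    finally show ?thesis by simp
  qed
  have "int p dvd m * int x + k - a \<longleftrightarrow> x = g a" if "x < p" for a x
  proof -
    have "int p dvd m * int x + k - a \<longleftrightarrow> [m * int x = a - k] (mod int p)"
      by (simp add: cong_iff_dvd_diff algebra_simps)
    also have "\<dots> \<longleftrightarrow> [m * int x = m * int (g a)] (mod int p)"
      using mg cong_sym cong_trans by blast
    also have "\<dots> \<longleftrightarrow> [int x = int (g a)] (mod int p)"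
      using cong_cancel[OF assms] cong_scalar_left by blast
    also have "\<dots> \<longleftrightarrow> x = g a"
      using that g(1) cong_less_modulus_unique_nat by (auto simp: cong_int_iff)
    finally show ?thesis .
  qed
  moreover have "int p dvd a - b" if "g a = g b" for a b
  proof -
    have "[a - k = b - k] (mod int p)" using mg[of a] mg[of b] that cong_sym cong_trans by metis
    then show ?thesis by (simp add: cong_iff_dvd_diff)
  qed
  ultimately show ?thesis using g(1) by blast
qed

text \<open>An invertible affine substitution permutes the residue classes, so the roots of
  \<open>cubic u\<close> are counted: none or three if the discriminant is a square, otherwise only
  \<open>sol u\<close>.\<close>

lemma card_cubic_affine:
  fixes k :: int
  assumes u: "\<not> int p dvd u" "\<not> int p dvd u - 1" "\<not> int p dvd u - 4" and m: "\<not> int p dvd m"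
  defines "S \<equiv> {x \<in> {0..<p}. int p dvd cubic u (m * int x + k)}"
  shows "card S = 3 \<longleftrightarrow> [sol u = 1] (mod int p)"
    and "card S = 1 \<longleftrightarrow> int p dvd cubic u (sol u)"
proof -
  obtain g where g: "\<And>a x. x < p \<Longrightarrow> int p dvd m * int x + k - a \<longleftrightarrow> x = g a" "\<And>a. g a < p"
    "\<And>a b. g a = g b \<Longrightarrow> int p dvd a - b"
    using affine_preimage[OF m, of k] by auto
  consider (none) "split_disc u" "\<not> (\<exists>t. int p dvd cubic u t)"
    | (three) t where "split_disc u" "int p dvd cubic u t"
    | (one) "\<not> split_disc u" by blast
  then have "(card S = 3 \<longleftrightarrow> split_disc u \<and> (\<exists>t. int p dvd cubic u t)) \<and> (card S = 1 \<longleftrightarrow> \<not> split_disc u)"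
  proof cases
    case none
    then have "S = {}" unfolding S_def by blast
    with none show ?thesis by simp
  next
    case three
    from three_roots[OF u(1,3) three(2,1)] obtain t1 t2 where
      ne: "\<not> int p dvd t1 - t" "\<not> int p dvd t2 - t" "\<not> int p dvd t1 - t2"
      and iff: "\<And>s. int p dvd cubic u s \<longleftrightarrow> int p dvd s - t \<or> int p dvd s - t1 \<or> int p dvd s - t2"
      by blast
    have "S = {g t, g t1, g t2}" unfolding S_def iff using g(1,2) by auto
    moreover have "g t \<noteq> g t1" "g t \<noteq> g t2" "g t1 \<noteq> g t2" using ne g(3) by metis+
    ultimately have "card S = 3" by simp
    with three show ?thesis by auto
  next
    case one
    then have root: "int p dvd cubic u (sol u)" using sol_root_iff u by blast
    have "int p dvd cubic u s \<longleftrightarrow> int p dvd s - sol u" for s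
    proof
      assume "int p dvd cubic u s"
      then show "int p dvd s - sol u" using second_root_disc[OF u(1,3) root] one by blast
    next
      assume "int p dvd s - sol u"
      then show "int p dvd cubic u s" using root cubic_dvd_cong[of s "sol u"] by (simp add: cong_iff_dvd_diff)
    qed
    then have "S = {g (sol u)}" unfolding S_def using g(1,2) by auto
    with one show ?thesis by simp
  qed
  then show "card S = 3 \<longleftrightarrow> [sol u = 1] (mod int p)" "card S = 1 \<longleftrightarrow> int p dvd cubic u (sol u)"
    using sol_eq_one_iff[OF u] sol_root_iff[OF u(1,3)] by blast+
qed

section \<open>Reduction of rationals modulo p\<close>

text \<open>Any denominator prime to p certifies membership, since the reduced denominator divides
  it. Closure proofs can thus use unreduced fractions.\<close>

lemma Z_loc_iff: "x \<in> Z_loc p \<longleftrightarrow> (\<exists>a b. \<not> int p dvd b \<and> x = of_int a / of_int b)"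
proof
  assume x: "x \<in> Z_loc p"
  obtain a b where ab: "quotient_of x = (a, b)" by (cases "quotient_of x")
  then have "x = of_int a / of_int b" by (rule quotient_of_div)
  with x ab show "\<exists>a b. \<not> int p dvd b \<and> x = of_int a / of_int b" unfolding Z_loc_def by auto
next
  assume "\<exists>a b. \<not> int p dvd b \<and> x = of_int a / of_int b"
  then obtain a b where b: "\<not> int p dvd b" and x: "x = of_int a / of_int b" by blast
  obtain c d where cd: "quotient_of x = (c, d)" by (cases "quotient_of x")
  have "d > 0" "coprime c d" "x = of_int c / of_int d"
    using cd quotient_of_denom_pos quotient_of_coprime quotient_of_div by blast+
  moreover have "b \<noteq> 0" using b by auto
  ultimately have "(of_int (a * d) :: rat) = of_int (c * b)"
    using x by (simp add: field_simps)
  then have "a * d = c * b" by (simp only: of_int_eq_iff)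
  then have "d dvd c * b" by (metis dvd_triv_right)
  then have "d dvd b" using \<open>coprime c d\<close> by (simp add: coprime_commute coprime_dvd_mult_right_iff)
  then show "x \<in> Z_loc p" using b cd dvd_trans unfolding Z_loc_def by auto
qed

lemma Z_loc_of_int: "of_int a \<in> Z_loc p"
  unfolding Z_loc_iff by (rule exI[of _ a], rule exI[of _ 1]) (use gt in simp)

lemma Z_loc_add: "x \<in> Z_loc p \<Longrightarrow> y \<in> Z_loc p \<Longrightarrow> x + y \<in> Z_loc p"
proof -
  assume "x \<in> Z_loc p" "y \<in> Z_loc p"
  then obtain a b c d where *: "\<not> int p dvd b" "x = of_int a / of_int b" "\<not> int p dvd d" "y = of_int c / of_int d"
    unfolding Z_loc_iff by blast
  then have "b \<noteq> 0" "d \<noteq> 0" by auto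
  with * have "x + y = of_int (a * d + c * b) / of_int (b * d)" by (simp add: field_simps)
  then show ?thesis unfolding Z_loc_iff using * dvd_mult_iff by blast
qed

lemma Z_loc_mult: "x \<in> Z_loc p \<Longrightarrow> y \<in> Z_loc p \<Longrightarrow> x * y \<in> Z_loc p"
proof -
  assume "x \<in> Z_loc p" "y \<in> Z_loc p"
  then obtain a b c d where *: "\<not> int p dvd b" "x = of_int a / of_int b" "\<not> int p dvd d" "y = of_int c / of_int d"
    unfolding Z_loc_iff by blast
  then have "x * y = of_int (a * c) / of_int (b * d)" by simp
  then show ?thesis unfolding Z_loc_iff using * dvd_mult_iff by blast
qed

text \<open>A relation rather than a residue function: no representative has to be chosen, and
  residues of compound expressions follow their structure.\<close>

definition reduces :: "rat \<Rightarrow> int \<Rightarrow> bool" where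
  "reduces x a \<longleftrightarrow> cong_loc p x (of_int a)"

lemma reduces_iff: "reduces x a \<longleftrightarrow> (\<exists>z\<in>Z_loc p. x = of_int a + of_nat p * z)"
  unfolding reduces_def cong_loc_def by (simp add: algebra_simps)

lemma reduces_of_int: "reduces (of_int a) a"
  unfolding reduces_iff using Z_loc_of_int[of 0] by (intro bexI[of _ 0]) auto

lemma reduces_exists:
  assumes "x \<in> Z_loc p"
  obtains a where "reduces x a"
proof -
  obtain a b where b: "\<not> int p dvd b" and x: "x = of_int a / of_int b" using assms unfolding Z_loc_iff by blast
  obtain c where "[b * c = a] (mod int p)" using inverse_mod b by blast
  then have "int p dvd a - b * c" by (simp add: cong_iff_dvd_diff dvd_diff_commute)
  then obtain k where k: "a = b * c + int p * k" by (metis dvd_def add_diff_cancel_left' diff_add_cancel add.commute)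
  have "b \<noteq> 0" using b by auto
  then have "x = of_int c + of_nat p * (of_int k / of_int b)" unfolding x k by (simp add: field_simps)
  moreover have "of_int k / of_int b \<in> Z_loc p" unfolding Z_loc_iff using b by blast
  ultimately have "reduces x c" unfolding reduces_iff by blast
  then show thesis by (rule that)
qed

lemma reduces_add: "reduces x a \<Longrightarrow> reduces y b \<Longrightarrow> reduces (x + y) (a + b)"
proof -
  assume "reduces x a" "reduces y b"
  then obtain v w where "v \<in> Z_loc p" "w \<in> Z_loc p" "x = of_int a + of_nat p * v" "y = of_int b + of_nat p * w"
    unfolding reduces_iff by blast
  then show ?thesis unfolding reduces_iff
    by (intro bexI[of _ "v + w"] Z_loc_add) (simp_all add: algebra_simps)
qed

lemma reduces_mult: "reduces x a \<Longrightarrow> reduces y b \<Longrightarrow> reduces (x * y) (a * b)"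
proof -
  assume "reduces x a" "reduces y b"
  then obtain v w where *: "v \<in> Z_loc p" "w \<in> Z_loc p" "x = of_int a + of_nat p * v" "y = of_int b + of_nat p * w"
    unfolding reduces_iff by blast
  then have "x * y = of_int (a * b) + of_nat p * (of_int a * w + v * of_int b + of_int (int p) * (v * w))"
    by (simp add: algebra_simps)
  moreover have "of_int a * w + v * of_int b + of_int (int p) * (v * w) \<in> Z_loc p"
    by (intro Z_loc_add Z_loc_mult Z_loc_of_int *)
  ultimately show ?thesis unfolding reduces_iff by blast
qed

lemma reduces_minus: "reduces x a \<Longrightarrow> reduces (- x) (- a)"
  using reduces_mult[OF reduces_of_int[of "- 1"]] by simp

lemma reduces_diff: "reduces x a \<Longrightarrow> reduces y b \<Longrightarrow> reduces (x - y) (a - b)"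
  using reduces_add[OF _ reduces_minus] by simp

lemma reduces_power: "reduces x a \<Longrightarrow> reduces (x ^ n) (a ^ n)"
  by (induction n) (use reduces_of_int[of 1] reduces_mult in auto)

lemma reduces_sum: "(\<And>i. i \<in> I \<Longrightarrow> reduces (f i) (g i)) \<Longrightarrow> reduces (sum f I) (sum g I)"
  by (induction I rule: infinite_finite_induct) (use reduces_of_int[of 0] reduces_add in auto)

lemma reduces_zero_iff: "reduces x 0 \<longleftrightarrow> cong_loc p x 0"
  by (simp add: reduces_def)

lemma of_int_Z_loc_dvd:
  assumes "of_int a = of_nat p * z" "z \<in> Z_loc p"
  shows "int p dvd a"
proof -
  obtain c d where d: "\<not> int p dvd d" and z: "z = of_int c / of_int d" using assms(2) unfolding Z_loc_iff by blast
  have "d \<noteq> 0" using d by auto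
  then have "(of_int (a * d) :: rat) = of_int (int p * c)" using assms(1) z by (simp add: field_simps)
  then have "a * d = int p * c" by (simp only: of_int_eq_iff)
  then have "int p dvd a * d" by simp
  then show ?thesis using d by (simp add: dvd_mult_iff)
qed

lemma reduces_cong:
  assumes "reduces x a"
  shows "reduces x b \<longleftrightarrow> [a = b] (mod int p)"
proof
  assume "reduces x b"
  with assms have "reduces (x - x) (a - b)" by (intro reduces_diff)
  then obtain z where "z \<in> Z_loc p" "0 = of_int (a - b) + of_nat p * z" unfolding reduces_iff by auto
  then have "of_int (b - a) = of_nat p * z" by simp
  then have "int p dvd b - a" using \<open>z \<in> Z_loc p\<close> by (rule of_int_Z_loc_dvd)
  then show "[a = b] (mod int p)" by (simp add: cong_iff_dvd_diff dvd_diff_commute)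
next
  assume "[a = b] (mod int p)"
  then obtain k where k: "a = b + int p * k" by (metis cong_iff_lin cong_sym)
  obtain z where z: "z \<in> Z_loc p" "x = of_int a + of_nat p * z" using assms unfolding reduces_iff by blast
  then have "x = of_int b + of_nat p * (of_int k + z)" unfolding k by (simp add: algebra_simps)
  then show "reduces x b" unfolding reduces_iff using Z_loc_add[OF Z_loc_of_int z(1)] by blast
qed

lemma cong_loc_zero_iff: "reduces x a \<Longrightarrow> cong_loc p x 0 \<longleftrightarrow> int p dvd a"
  unfolding reduces_zero_iff[symmetric] reduces_cong cong_0_iff ..

text \<open>Since its residue b is prime to p, y is a unit of the localization; so x / y - c is p
  times the product of z and 1 / y, both in \<open>Z_loc p\<close>.\<close>

lemma reduces_divide:
  assumes x: "reduces x a" and y: "reduces y b" and b: "\<not> int p dvd b" and c: "[b * c = a] (mod int p)"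
  shows "reduces (x / y) c"
proof -
  have "reduces (x - y * of_int c) (a - b * c)" by (intro reduces_diff reduces_mult x y reduces_of_int)
  then have "reduces (x - y * of_int c) 0"
    using c by (subst reduces_cong) (simp_all add: cong_0_iff cong_iff_dvd_diff dvd_diff_commute)
  then obtain z where z: "z \<in> Z_loc p" "x - y * of_int c = of_nat p * z" unfolding reduces_iff by auto
  obtain v where v: "v \<in> Z_loc p" "y = of_int b + of_nat p * v" using y unfolding reduces_iff by blast
  obtain e f where f: "\<not> int p dvd f" "v = of_int e / of_int f" using v(1) unfolding Z_loc_iff by blast
  have "f \<noteq> 0" using f by auto
  then have y': "y = of_int (b * f + int p * e) / of_int f" using v f by (simp add: field_simps)
  have nd: "\<not> int p dvd b * f + int p * e" using b f(1) by (simp add: dvd_add_left_iff dvd_mult_iff)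
  then have "b * f + int p * e \<noteq> 0" by (metis dvd_0_right)
  then have y0: "y \<noteq> 0" "1 / y = of_int f / of_int (b * f + int p * e)" unfolding y' using \<open>f \<noteq> 0\<close>
    by (simp_all only: divide_divide_eq_right of_int_eq_0_iff divide_eq_0_iff mult_1_left simp_thms)
  then have "1 / y \<in> Z_loc p" unfolding Z_loc_iff using nd by blast
  then have "z * (1 / y) \<in> Z_loc p" using z(1) by (intro Z_loc_mult)
  moreover have "x / y = of_int c + of_nat p * (z * (1 / y))"
    using z(2) y0(1) by (simp add: field_simps)
  ultimately show ?thesis unfolding reduces_iff by blast
qed

end

section \<open>Transfer to the given cubic\<close>

theorem theorem2p2:
  fixes p :: nat and a1 a2 a3 P Q :: rat
  assumes "prime p" and "p > 3"
    and "a1 \<in> Z_loc p" and "a2 \<in> Z_loc p" and "a3 \<in> Z_loc p"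
    and "P = - 2 * a1 ^ 3 + 9 * a1 * a2 - 27 * a3"
    and "Q = (a1 ^ 2 - 3 * a2) ^ 3"
    and "\<not> cong_loc p (P * Q * (P ^ 2 - Q) * (P ^ 2 - 3 * Q) * (P ^ 2 - 4 * Q)) 0"
  shows "(num_sols p [:a3, a2, a1, 1:] = 3 \<longleftrightarrow>
           cong_loc p
             (\<Sum>k = 1..p div 3. of_nat ((3 * k) choose k) * ((4 * Q - P ^ 2) / (27 * Q)) ^ k) 0)
       \<and> (num_sols p [:a3, a2, a1, 1:] = 1 \<longleftrightarrow>
           (let x = P / (3 * (a1 ^ 2 - 3 * a2)) *
                      (\<Sum>k = 0..p div 3. of_nat ((3 * k) choose k) * ((4 * Q - P ^ 2) / (27 * Q)) ^ k)
                    - a1 / 3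
            in cong_loc p (x ^ 3 + a1 * x ^ 2 + a2 * x + a3) 0))"
proof -
  interpret prime_gt_three p using assms(1,2) by unfold_locales
  note red = reduces_add reduces_diff reduces_mult reduces_power reduces_of_int
  have num: "reduces (numeral n) (numeral n)" for n using reduces_of_int[of "numeral n"] by simp
  obtain A1 A2 A3 where A: "reduces a1 A1" "reduces a2 A2" "reduces a3 A3"
    using reduces_exists assms(3-5) by metis
  define C where "C = A1\<^sup>2 - 3 * A2"
  define R where "R = - 2 * A1 ^ 3 + 9 * A1 * A2 - 27 * A3"
  have C: "reduces (a1\<^sup>2 - 3 * a2) C" unfolding C_def by (intro red num A)
  have P: "reduces P R" unfolding R_def assms(6) by (intro red num A reduces_minus)
  have Q: "reduces Q (C ^ 3)" unfolding assms(7) by (intro red C)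
  have "reduces (P * Q * (P ^ 2 - Q) * (P ^ 2 - 3 * Q) * (P ^ 2 - 4 * Q))
    (R * C ^ 3 * (R\<^sup>2 - C ^ 3) * (R\<^sup>2 - 3 * C ^ 3) * (R\<^sup>2 - 4 * C ^ 3))"
    by (intro red num P Q)
  then have "\<not> int p dvd R * C ^ 3 * (R\<^sup>2 - C ^ 3) * (R\<^sup>2 - 3 * C ^ 3) * (R\<^sup>2 - 4 * C ^ 3)"
    using assms(8) cong_loc_zero_iff by blast
  then have nd: "\<not> int p dvd R" "\<not> int p dvd C" "\<not> int p dvd R\<^sup>2 - C ^ 3" "\<not> int p dvd R\<^sup>2 - 4 * C ^ 3"
    by (auto simp: dvd_mult_iff dvd_power_iff)
  have nC: "\<not> int p dvd C ^ 3" using nd by (simp add: dvd_power_iff)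
  obtain u where u: "[C ^ 3 * u = R\<^sup>2] (mod int p)" using inverse_mod nC by blast
  have nu: "\<not> int p dvd u - a" if "\<not> int p dvd R\<^sup>2 - a * C ^ 3" for a
  proof
    assume "int p dvd u - a"
    then have "int p dvd C ^ 3 * (u - a)" by (rule dvd_mult)
    moreover have "[C ^ 3 * u - C ^ 3 * a = R\<^sup>2 - C ^ 3 * a] (mod int p)" by (intro cong_diff u cong_refl)
    ultimately have "int p dvd R\<^sup>2 - C ^ 3 * a" using cong_dvd_iff by (metis right_diff_distrib)
    then show False using that by (simp add: mult.commute)
  qed
  have nu0: "\<not> int p dvd u" and nu1: "\<not> int p dvd u - 1" and nu4: "\<not> int p dvd u - 4"
    using nu[of 0] nu[of 1] nu[of 4] nd by (simp_all add: dvd_power_iff)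
  define r where "r = (4 * Q - P ^ 2) / (27 * Q)"
  have n27: "\<not> int p dvd 27 * C ^ 3" using nC by (simp add: dvd_mult_iff)
  obtain z where z: "[27 * C ^ 3 * z = 4 * C ^ 3 - R\<^sup>2] (mod int p)" using inverse_mod n27 by blast
  have r: "reduces r z" unfolding r_def by (rule reduces_divide[OF _ _ n27 z]) (intro red num P Q)+
  have "[4 * C ^ 3 - R\<^sup>2 = 4 * C ^ 3 - C ^ 3 * u] (mod int p)" by (intro cong_diff cong_sym[OF u] cong_refl)
  with z have "[27 * C ^ 3 * z = 4 * C ^ 3 - C ^ 3 * u] (mod int p)" by (rule cong_trans)
  then have "[C ^ 3 * (27 * z) = C ^ 3 * (4 - u)] (mod int p)" by (simp add: algebra_simps)
  then have zu: "[27 * z = 4 - u] (mod int p)" by (rule cong_cancel[OF nC])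
  define S where "S = (\<Sum>k = 0..p div 3. of_nat ((3 * k) choose k) * r ^ k)"
  have "reduces S (\<Sum>k = 0..p div 3. int ((3 * k) choose k) * z ^ k)"
    unfolding S_def
  proof (rule reduces_sum)
    fix k
    show "reduces (of_nat ((3 * k) choose k) * r ^ k) (int ((3 * k) choose k) * z ^ k)"
      using reduces_mult[OF reduces_of_int[of "int ((3 * k) choose k)"] reduces_power[OF r]] by simp
  qed
  moreover have "[(\<Sum>k = 0..p div 3. int ((3 * k) choose k) * z ^ k) = sol u] (mod int p)"
    using binomial_sum_cong_sol[OF zu] by (simp add: atMost_atLeast0)
  ultimately have S: "reduces S (sol u)" using reduces_cong by blast
  \<comment> \<open>The term k = 0 is 1, so the sum starting at k = 1 has residue
    \<open>sol u - 1\<close>.\<close>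
  have "S = 1 + (\<Sum>k = 1..p div 3. of_nat ((3 * k) choose k) * r ^ k)"
    unfolding S_def by (subst sum.atLeast_Suc_atMost) simp_all
  then have S1: "reduces (\<Sum>k = 1..p div 3. of_nat ((3 * k) choose k) * r ^ k) (sol u - 1)"
    using reduces_diff[OF S reduces_of_int[of 1]] by simp
  define F where "F x = x ^ 3 + A1 * x\<^sup>2 + A2 * x + A3" for x
  have F: "reduces (x ^ 3 + a1 * x\<^sup>2 + a2 * x + a3) (F y)" if "reduces x y" for x y
    unfolding F_def by (intro red A that)
  obtain j where j: "[R * j = 1] (mod int p)" using inverse_mod nd(1) by blast
  have nj: "\<not> int p dvd j"
    using cong_dvd_iff[OF j] not_dvd_1 dvd_mult by blast
  \<comment> \<open>Chosen so that m x + k = C (3 x + A1) / R, which solves x = (P t / (a1^2 - 3 a2)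
    - a1) / 3 for t modulo p.\<close>
  define m k where "m = 3 * C * j" and "k = C * j * A1"
  have m: "\<not> int p dvd m" using nj nd by (simp add: m_def dvd_mult_iff)
  have FG: "int p dvd F x \<longleftrightarrow> int p dvd cubic u (m * x + k)" for x
  proof -
    define y where "y = 3 * x + A1"
    have mk: "m * x + k = C * j * y" by (simp add: m_def k_def y_def algebra_simps)
    \<comment> \<open>Multiplying by R clears the inverse j and gives y^3 - 3 C y - R, the depressed
      form of 27 times the given cubic.\<close>
    have "R * cubic u (m * x + k) = (C ^ 3 * u) * (R * j) * j\<^sup>2 * y ^ 3 - 3 * (R * j) * (C * y) - R"
      unfolding mk by (simp add: cubic_def power2_eq_square power3_eq_cube algebra_simps)
    also have "[\<dots> = R\<^sup>2 * (R * j) * j\<^sup>2 * y ^ 3 - 3 * 1 * (C * y) - R] (mod int p)"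
      by (intro cong_diff cong_mult u j cong_refl)
    also have "R\<^sup>2 * (R * j) * j\<^sup>2 * y ^ 3 - 3 * 1 * (C * y) - R = (R * j) ^ 3 * y ^ 3 - 3 * C * y - R"
      by (simp add: power2_eq_square power3_eq_cube algebra_simps)
    also have "[\<dots> = 1 ^ 3 * y ^ 3 - 3 * C * y - R] (mod int p)"
      by (intro cong_diff cong_mult cong_pow j cong_refl)
    also have "1 ^ 3 * y ^ 3 - 3 * C * y - R = 27 * F x"
      by (simp add: y_def C_def R_def F_def power2_eq_square power3_eq_cube algebra_simps)
    finally have "int p dvd R * cubic u (m * x + k) \<longleftrightarrow> int p dvd 27 * F x" by (rule cong_dvd_iff)
    then show ?thesis using nd by (simp add: dvd_mult_iff)
  qed
  have "num_sols p [:a3, a2, a1, 1:] = card {x \<in> {0..<p}. int p dvd cubic u (m * int x + k)}"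
  proof -
    have "cong_loc p (poly [:a3, a2, a1, 1:] (of_nat x)) 0 \<longleftrightarrow> int p dvd cubic u (m * int x + k)" for x
    proof -
      have "poly [:a3, a2, a1, 1:] (of_nat x) = of_int (int x) ^ 3 + a1 * (of_int (int x))\<^sup>2 + a2 * of_int (int x) + a3"
        by (simp add: power2_eq_square power3_eq_cube algebra_simps)
      then show ?thesis by (simp only: cong_loc_zero_iff[OF F[OF reduces_of_int]] FG)
    qed
    then show ?thesis by (simp only: num_sols_def)
  qed
  then have card: "num_sols p [:a3, a2, a1, 1:] = 3 \<longleftrightarrow> [sol u = 1] (mod int p)"
    "num_sols p [:a3, a2, a1, 1:] = 1 \<longleftrightarrow> int p dvd cubic u (sol u)"
    by (simp_all only: card_cubic_affine[OF nu0 nu1 nu4 m])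
  define x where "x = P / (3 * (a1 ^ 2 - 3 * a2)) * S - a1 / 3"
  have n3C: "\<not> int p dvd 3 * C" using nd by (simp add: dvd_mult_iff)
  obtain w where w: "[3 * C * w = R] (mod int p)" using inverse_mod n3C by blast
  obtain b where b: "[3 * b = A1] (mod int p)" using inverse_mod not_dvd_3 by blast
  have "reduces (P / (3 * (a1 ^ 2 - 3 * a2))) w"
    by (rule reduces_divide[OF P _ n3C w]) (intro red num C)
  moreover have "reduces (a1 / 3) b" by (rule reduces_divide[OF A(1) num not_dvd_3 b])
  ultimately have x: "reduces x (w * sol u - b)" unfolding x_def by (intro red S)
  \<comment> \<open>The residue of the proposed solution corresponds to t = \<open>sol u\<close>
    under the substitution.\<close>
  have "m * (w * sol u - b) + k = j * sol u * (3 * C * w) - C * j * (3 * b) + C * j * A1"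
    by (simp add: m_def k_def algebra_simps)
  also have "[\<dots> = j * sol u * R - C * j * A1 + C * j * A1] (mod int p)"
    by (intro cong_add cong_diff cong_scalar_left w b cong_refl)
  also have "j * sol u * R - C * j * A1 + C * j * A1 = (R * j) * sol u" by (simp add: algebra_simps)
  also have "[(R * j) * sol u = 1 * sol u] (mod int p)" by (intro cong_scalar_right j)
  finally have "[m * (w * sol u - b) + k = sol u] (mod int p)" by simp
  then have "int p dvd cubic u (m * (w * sol u - b) + k) \<longleftrightarrow> int p dvd cubic u (sol u)"
    by (rule cubic_dvd_cong)
  then have c1: "cong_loc p (x ^ 3 + a1 * x\<^sup>2 + a2 * x + a3) 0 \<longleftrightarrow> int p dvd cubic u (sol u)"
    by (simp only: cong_loc_zero_iff[OF F[OF x]] FG)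
  have c3: "cong_loc p (\<Sum>k = 1..p div 3. of_nat ((3 * k) choose k) * r ^ k) 0 \<longleftrightarrow> [sol u = 1] (mod int p)"
    using cong_loc_zero_iff[OF S1] by (simp only: cong_iff_dvd_diff)
  show ?thesis
    unfolding Let_def card r_def[symmetric] S_def[symmetric] x_def[symmetric] c1 c3 by (intro conjI refl)
qed

end
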